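(* Let $f:\mathbb{R}^{m\times n}\to\mathbb{R}$ be twice continuously differentiable, $\bar f=f\circ\phi$, and let $(X,G)\in\mathcal{M}_h$ have the representation $(H,V)$. Then the Riemannian gradient $\nabla_{\mathcal{M}_h}\bar f(X,G)$ is represented by $$\bar K=\mathcal{P}_{\mathrm{T}_H\mathcal{H}^r}(\nabla f(X)V),\qquad \bar V_p=G\,\nabla f(X)^\top H\,M_{H,\omega}^{-1},$$ that is, $\nabla_{\mathcal{M}_h}\bar f(X,G)=(\bar KV^\top+H\bar V_p^\top,\ -\bar V_pV^\top-V\bar V_p^\top)$ with $\bar K\in\mathrm{T}_H\mathcal{H}^r$ and $V^\top\bar V_p=0$.
   Context: Let $r\le\min\{m,n\}$ be a positive integer. The map $h:\mathbb{R}^{m\times n}\to\mathbb{R}^q$ is smooth and orthogonally invariant, i.e. $h(XQ)=h(X)$ for all $X$ and all $Q\in\mathcal{O}(n)=\{Q\in\mathbb{R}^{n\times n}:Q^\top Q=I_n\}$. Put $\mathcal{H}=\{X\in\mathbb{R}^{m\times n}:h(X)=0\}$; it is assumed that the differential $\mathrm{D}h_X$ has rank $q$ for all $X\in\mathcal{H}$. Define $\mathcal{H}^r=\{H\in\mathbb{R}^{m\times r}:h([H\ \ 0^{m\times(n-r)}])=0\}$, an embedded submanifold of $\mathbb{R}^{m\times r}$ when nonempty. $\mathrm{Sym}(n)$: symmetric $n\times n$ matrices; $\mathrm{Gr}(n,n-r)=\{G\in\mathrm{Sym}(n):G^2=G,\operatorname{rank}(G)=n-r\}$; $\mathrm{St}(n,r)=\{V\in\mathbb{R}^{n\times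 r}:V^\top V=I_r\}$. Define $\mathcal{M}_h=\{(X,G)\in\mathbb{R}^{m\times n}\times\mathrm{Gr}(n,n-r):XG=0,\ h(X)=0\}$, an embedded submanifold of $\mathcal{E}=\mathbb{R}^{m\times n}\times\mathrm{Sym}(n)$, and $\phi(X,G)=X$. A representation of $(X,G)\in\mathcal{M}_h$ is a pair $(H,V)\in\mathcal{H}^r\times\mathrm{St}(n,r)$ with $X=HV^\top$, $G=I-VV^\top$ (one always exists). The tangent space is $\mathrm{T}_{(X,G)}\mathcal{M}_h=\{(KV^\top+HV_p^\top,-V_pV^\top-VV_p^\top):K\in\mathrm{T}_H\mathcal{H}^r,\ V_p\in\mathbb{R}^{n\times r},\ V^\top V_p=0\}$, and $(K,V_p)$ is said to represent the corresponding tangent vector. For a fixed weight $\omega>0$, $\mathcal{M}_h$ carries the Riemannian metric inherited from the inner product $\langle(E_1,Z_1),(E_2,Z_2)\rangle_\omega=\langle E_1,E_2\rangle+\omega\langle Z_1,Z_2\rangle$ on $\mathcal{E}$, where $\langle A,B\rangle=\mathrm{tr}(A^\top B)$. $M_{H,\omega}=2\omega I+H^\top H$. $\mathcal{P}_{\mathcal{X}}$ denotes orthogonal projection onto $\mathcal{X}$ (Frobenius), and $\nabla f$ is the Euclidean gradient. *)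

theory Defs
  imports "HOL-Analysis.Analysis"
begin

text \<open>On an open set of a Euclidean space a map is of class \<open>C\<^sup>k\<^sup>+\<^sup>1\<close> iff it is differentiable and
  all its directional derivatives are of class \<open>C\<^sup>k\<close>. The predicate is only meant for open \<open>S\<close>.\<close>

fun Ck_on :: "nat \<Rightarrow> 'a::euclidean_space set \<Rightarrow> ('a \<Rightarrow> 'b::real_normed_vector) \<Rightarrow> bool" where
  "Ck_on 0 S f \<longleftrightarrow> continuous_on S f"
| "Ck_on (Suc k) S f \<longleftrightarrow> (\<forall>x\<in>S. f differentiable (at x)) \<and>
     (\<forall>v. Ck_on k S (\<lambda>x. frechet_derivative f (at x) v))"

definition smooth_on :: "'a::euclidean_space set \<Rightarrow> ('a \<Rightarrow> 'b::real_normed_vector) \<Rightarrow> bool" where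
  "smooth_on S f \<longleftrightarrow> (\<forall>k. Ck_on k S f)"

definition euclidean_gradient :: "('a::real_inner \<Rightarrow> real) \<Rightarrow> 'a \<Rightarrow> 'a" where
  "euclidean_gradient f x = (THE D. GDERIV f x :> D)"

text \<open>Tangent vectors of an embedded submanifold are the velocities of smooth curves in it.\<close>

definition smooth_curve_through :: "'a::real_normed_vector set \<Rightarrow> 'a \<Rightarrow> (real \<Rightarrow> 'a) \<Rightarrow> bool" where
  "smooth_curve_through M x c \<longleftrightarrow>
     c 0 = x \<and> (\<exists>\<epsilon>>0. smooth_on {-\<epsilon><..<\<epsilon>} c \<and> c ` {-\<epsilon><..<\<epsilon>} \<subseteq> M)"

definition tangent_space :: "'a::real_normed_vector set \<Rightarrow> 'a \<Rightarrow> 'a set" where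
  "tangent_space M x =
     {v. \<exists>c. smooth_curve_through M x c \<and> (c has_vector_derivative v) (at 0)}"

text \<open>The differential of \<open>g\<close> at \<open>x\<close> along the tangent vector \<open>c'(0)\<close> is \<open>(g \<circ> c)'(0)\<close>, so
  only the values of \<open>g\<close> on \<open>M\<close> matter. The metric on \<open>M\<close> is the restriction of the
  inner product \<open>ip\<close> of the ambient space.\<close>

definition has_riemannian_gradient ::
  "('a::real_normed_vector \<Rightarrow> 'a \<Rightarrow> real) \<Rightarrow> 'a set \<Rightarrow> ('a \<Rightarrow> real) \<Rightarrow> 'a \<Rightarrow> 'a \<Rightarrow> bool" where
  "has_riemannian_gradient ip M g x \<xi> \<longleftrightarrow> \<xi> \<in> tangent_space M x \<and>
     (\<forall>c v. smooth_curve_through M x c \<and> (c has_vector_derivative v) (at 0) \<longrightarrow>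
        ((\<lambda>t. g (c t)) has_real_derivative ip \<xi> v) (at 0))"

definition riemannian_gradient ::
  "('a::real_normed_vector \<Rightarrow> 'a \<Rightarrow> real) \<Rightarrow> 'a set \<Rightarrow> ('a \<Rightarrow> real) \<Rightarrow> 'a \<Rightarrow> 'a" where
  "riemannian_gradient ip M g x = (THE \<xi>. has_riemannian_gradient ip M g x \<xi>)"

definition frob :: "real^'n^'m \<Rightarrow> real^'n^'m \<Rightarrow> real" where
  "frob A B = trace (transpose A ** B)"

lemma frob_eq_inner: "frob A B = A \<bullet> B"
proof -
  have "frob A B = (\<Sum>j\<in>UNIV. \<Sum>i\<in>UNIV. A $ i $ j * B $ i $ j)"
    by (simp add: frob_def trace_def matrix_matrix_mult_def transpose_def)
  also have "\<dots> = (\<Sum>i\<in>UNIV. \<Sum>j\<in>UNIV. A $ i $ j * B $ i $ j)"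
    by (rule sum.swap)
  finally show ?thesis
    by (simp add: inner_vec_def)
qed

definition weighted_ip ::
  "real \<Rightarrow> (real^'n^'m) \<times> (real^'n^'n) \<Rightarrow> (real^'n^'m) \<times> (real^'n^'n) \<Rightarrow> real" where
  "weighted_ip \<omega> = (\<lambda>(E1, Z1) (E2, Z2). frob E1 E2 + \<omega> * frob Z1 Z2)"

text \<open>Intended for linear subspaces \<open>S\<close>, where such a point exists and is unique.\<close>

definition orthogonal_projection :: "(real^'n^'m) set \<Rightarrow> real^'n^'m \<Rightarrow> real^'n^'m" where
  "orthogonal_projection S A = (THE P. P \<in> S \<and> (\<forall>Z\<in>S. frob (A - P) Z = 0))"

definition orthogonally_invariant :: "(real^'n^'m \<Rightarrow> 'b) \<Rightarrow> bool" where
  "orthogonally_invariant h \<longleftrightarrow> (\<forall>X Q. orthogonal_matrix Q \<longrightarrow> h (X ** Q) = h X)"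

definition full_rank_on_zeros :: "(real^'n^'m \<Rightarrow> real^'q) \<Rightarrow> bool" where
  "full_rank_on_zeros h \<longleftrightarrow>
     (\<forall>X. h X = 0 \<longrightarrow> dim (range (frechet_derivative h (at X))) = CARD('q))"

definition grassmannian :: "nat \<Rightarrow> (real^'n^'n) set" where
  "grassmannian k = {G. transpose G = G \<and> G ** G = G \<and> rank G = k}"

definition stiefel :: "(real^'r^'n) set" where
  "stiefel = {V. transpose V ** V = mat 1}"

text \<open>The block matrix \<open>[H 0]\<close>. The column index types carry no order, so an injection \<open>\<iota>\<close>
  says which columns of the wide matrix are the leading \<open>r\<close> ones, and in which order.\<close>

definition pad_columns :: "('r::finite \<Rightarrow> 'n::finite) \<Rightarrow> real^'r^'m \<Rightarrow> real^'n^'m" where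
  "pad_columns \<iota> H = (\<chi> i j. if j \<in> range \<iota> then H $ i $ inv \<iota> j else 0)"

definition Hr :: "('r::finite \<Rightarrow> 'n::finite) \<Rightarrow> (real^'n^'m \<Rightarrow> real^'q) \<Rightarrow> (real^'r^'m) set" where
  "Hr \<iota> h = {H. h (pad_columns \<iota> H) = 0}"

definition Mh :: "nat \<Rightarrow> (real^'n^'m \<Rightarrow> real^'q) \<Rightarrow> ((real^'n^'m) \<times> (real^'n^'n)) set" where
  "Mh r h = {(X, G). G \<in> grassmannian (CARD('n) - r) \<and> X ** G = 0 \<and> h X = 0}"

definition represents_point ::
  "('r::finite \<Rightarrow> 'n::finite) \<Rightarrow> (real^'n^'m \<Rightarrow> real^'q) \<Rightarrow>
     real^'r^'m \<Rightarrow> real^'r^'n \<Rightarrow> (real^'n^'m) \<times> (real^'n^'n) \<Rightarrow> bool" where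
  "represents_point \<iota> h H V = (\<lambda>(X, G). H \<in> Hr \<iota> h \<and> V \<in> stiefel \<and>
     X = H ** transpose V \<and> G = mat 1 - V ** transpose V)"

definition represents_tangent ::
  "('r::finite \<Rightarrow> 'n::finite) \<Rightarrow> (real^'n^'m \<Rightarrow> real^'q) \<Rightarrow> real^'r^'m \<Rightarrow> real^'r^'n \<Rightarrow>
     real^'r^'m \<Rightarrow> real^'r^'n \<Rightarrow> (real^'n^'m) \<times> (real^'n^'n) \<Rightarrow> bool" where
  "represents_tangent \<iota> h H V K Vp \<xi> \<longleftrightarrow>
     K \<in> tangent_space (Hr \<iota> h) H \<and> transpose V ** Vp = 0 \<and>
     \<xi> = (K ** transpose V + H ** transpose Vp,
          - (Vp ** transpose V) - V ** transpose Vp)"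

definition M_weight :: "real \<Rightarrow> real^'r^'m \<Rightarrow> real^'r^'r" where
  "M_weight \<omega> H = (2 * \<omega>) *\<^sub>R mat 1 + transpose H ** H"

end

theory Submission
  imports Defs
begin

text \<open>
  The Riemannian gradient of \<open>f \<circ> fst\<close> is the tangent vector \<open>\<xi>\<close> whose weighted inner product with
  every tangent vector \<open>(X', G')\<close> is \<open>\<langle>\<nabla>f(X), X'\<rangle>\<close>. Once it is known that the tangent vectors at \<open>(X, G)\<close>
  are exactly those represented by pairs \<open>(K, V\<^sub>p)\<close> with \<open>K\<close> tangent to \<open>\<H>\<^sup>r\<close> at \<open>H\<close> and \<open>V\<^sup>T V\<^sub>p = 0\<close>, this
  is linear algebra. In these coordinates the metric is
  \<open>\<langle>K\<^sub>1, K\<^sub>2\<rangle> + \<langle>V\<^sub>1 M, V\<^sub>2\<rangle>\<close> with \<open>M = 2 \<omega> 1 + H\<^sup>T H\<close> (\<open>weighted_ip_represented\<close>), and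
  \<open>\<langle>\<nabla>f(X), K V\<^sup>T + H V\<^sub>p\<^sup>T\<rangle> = \<langle>\<nabla>f(X) V, K\<rangle> + \<langle>G \<nabla>f(X)\<^sup>T H, V\<^sub>p\<rangle>\<close>. Comparing the two expressions gives the
  formula: the \<open>K\<close>-part is a projection because \<open>K\<close> ranges over a subspace, and \<open>M\<close> is positive
  definite, hence invertible.

  Tangent vectors are velocities of smooth curves in the manifold, so the description of the tangent
  space has two halves. That every velocity is represented follows by differentiating the equations
  that define the manifold (\<open>tangent_vector_Mh_represented\<close>). Conversely, a represented vector needs
  a curve (\<open>represents_tangent_in_tangent_space_Mh\<close>): a curve in \<open>\<H>\<^sup>r\<close> is combined with a curve of orthogonal
  matrices given by a Cayley transform (\<open>cayley_curve\<close>).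

  The tangent space of \<open>\<H>\<^sup>r\<close> is computed as that of a regular level set (\<open>tangent_space_level_set\<close>).
  Orthogonal invariance enters through a reflection that fixes \<open>X\<close>: it forces the differential of \<open>h\<close>
  to vanish on all matrices \<open>E G\<close> (\<open>orthogonally_invariant_derivative_zero\<close>), so \<open>h\<close> stays regular
  when it is restricted to the matrices \<open>K V\<^sup>T\<close>, and the directions \<open>H V\<^sub>p\<^sup>T\<close> are unconstrained.

  The analytic core is that solutions of linear equations depend on a parameter as smoothly as the
  equations do (\<open>Ck_on_linear_solve\<close>). It upgrades the differentiable inverse function theorem to
  smooth curves and makes the Cayley transform smooth.
\<close>

section \<open>Calculus of maps of class \<open>C\<^sup>k\<close>\<close>

lemma Ck_on_subset: "Ck_on k T f \<Longrightarrow> S \<subseteq> T \<Longrightarrow> Ck_on k S f"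
  by (induction k arbitrary: f) (auto intro: continuous_on_subset)

lemma Ck_on_Suc_imp_Ck_on: "Ck_on (Suc k) S f \<Longrightarrow> Ck_on k S f"
proof (induction k arbitrary: f)
  case 0
  then show ?case
    by (auto intro!: continuous_at_imp_continuous_on differentiable_imp_continuous_within)
next
  case (Suc k)
  then show ?case
    by (subst Ck_on.simps) (metis Ck_on.simps(2))
qed

lemma Ck_on_SucD:
  assumes "Ck_on (Suc k) S f"
  obtains f' where "\<And>x. x \<in> S \<Longrightarrow> (f has_derivative f' x) (at x)"
    and "\<And>v. Ck_on k S (\<lambda>x. f' x v)"
  by (rule that[of "\<lambda>x. frechet_derivative f (at x)"])
    (use assms in \<open>simp_all add: frechet_derivative_works\<close>)

lemma frechet_derivative_eqI:
  "(f has_derivative f') (at x) \<Longrightarrow> frechet_derivative f (at x) = f'"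
  using frechet_derivative_at by metis

lemma Ck_on_cong:
  assumes "open S" and "\<And>x. x \<in> S \<Longrightarrow> f x = g x" and "Ck_on k S g"
  shows "Ck_on k S f"
  using assms(2,3)
proof (induction k arbitrary: f g)
  case 0
  then show ?case
    using continuous_on_cong[of S S f g] by simp
next
  case (Suc k)
  have eq: "(f has_derivative D) (at x) \<longleftrightarrow> (g has_derivative D) (at x)" if "x \<in> S" for x D
    using has_derivative_transform_within_open[OF _ assms(1) that] Suc.prems(1) by metis
  have "frechet_derivative f (at x) v = frechet_derivative g (at x) v" if "x \<in> S" for x v
    unfolding frechet_derivative_def eq[OF that] by simp
  then have "Ck_on k S (\<lambda>x. frechet_derivative f (at x) v)" for v
    by (rule Suc.IH) (use Suc.prems(2) in simp_all)
  moreover have "f differentiable (at x)" if "x \<in> S" for x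
    using Suc.prems(2) eq[OF that] that by (simp add: differentiable_def)
  ultimately show ?case
    by simp
qed

text \<open>The recursive clause of \<open>Ck_on\<close> speaks of the Frechet derivative chosen by a description
  operator. This rule and the destruction rule above let inductions on \<open>k\<close> work with any
  explicit derivative.\<close>

lemma Ck_on_SucI:
  assumes "open S" and f': "\<And>x. x \<in> S \<Longrightarrow> (f has_derivative f' x) (at x)"
    and "\<And>v. Ck_on k S (\<lambda>x. f' x v)"
  shows "Ck_on (Suc k) S f"
proof -
  have "Ck_on k S (\<lambda>x. frechet_derivative f (at x) v)" for v
    by (rule Ck_on_cong[OF assms(1) _ assms(3)[of v]])
      (simp add: frechet_derivative_eqI[OF f'])
  then show ?thesis
    using f' by (auto simp: differentiable_def)
qed

lemma Ck_on_const [simp]: "Ck_on k S (\<lambda>x. c)"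
  by (induction k arbitrary: c) (auto simp: frechet_derivative_const)

lemma Ck_on_id: "open S \<Longrightarrow> Ck_on k S (\<lambda>x. x)"
  by (cases k) (auto intro!: Ck_on_SucI[where f' = "\<lambda>x v. v"] derivative_eq_intros)

lemma Ck_on_bounded_linear:
  assumes "open S" and L: "bounded_linear L" and "Ck_on k S f"
  shows "Ck_on k S (\<lambda>x. L (f x))"
  using assms(3)
proof (induction k arbitrary: f)
  case 0
  then show ?case
    by (simp add: bounded_linear.continuous_on[OF L])
next
  case (Suc k)
  from Ck_on_SucD[OF Suc.prems] obtain f' where
    "\<And>x. x \<in> S \<Longrightarrow> (f has_derivative f' x) (at x)" and "\<And>v. Ck_on k S (\<lambda>x. f' x v)"
    by blast
  then show ?case
    using bounded_linear.has_derivative[OF L, where F = "at _"] Suc.IH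
    by (intro Ck_on_SucI[OF assms(1), where f' = "\<lambda>x v. L (f' x v)"]) blast+
qed

lemma Ck_on_add:
  assumes "open S" and "Ck_on k S f" and "Ck_on k S g"
  shows "Ck_on k S (\<lambda>x. f x + g x)"
  using assms(2,3)
proof (induction k arbitrary: f g)
  case 0
  then show ?case
    by (simp add: continuous_on_add)
next
  case (Suc k)
  from Ck_on_SucD[OF Suc.prems(1)] obtain f' where
    "\<And>x. x \<in> S \<Longrightarrow> (f has_derivative f' x) (at x)" and "\<And>v. Ck_on k S (\<lambda>x. f' x v)"
    by blast
  moreover from Ck_on_SucD[OF Suc.prems(2)] obtain g' where
    "\<And>x. x \<in> S \<Longrightarrow> (g has_derivative g' x) (at x)" and "\<And>v. Ck_on k S (\<lambda>x. g' x v)"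
    by blast
  ultimately show ?case
    using Suc.IH
    by (intro Ck_on_SucI[OF assms(1), where f' = "\<lambda>x v. f' x v + g' x v"]) (auto intro: has_derivative_add)
qed

lemma Ck_on_sum:
  assumes "open S" and "\<And>i. i \<in> I \<Longrightarrow> Ck_on k S (f i)"
  shows "Ck_on k S (\<lambda>x. \<Sum>i\<in>I. f i x)"
  using assms(2) by (induction I rule: infinite_finite_induct) (auto intro: Ck_on_add[OF assms(1)])

lemma Ck_on_bilinear:
  assumes "open S" and B: "bounded_bilinear B" and "Ck_on k S f" and "Ck_on k S g"
  shows "Ck_on k S (\<lambda>x. B (f x) (g x))"
  using assms(3,4)
proof (induction k arbitrary: f g)
  case 0
  then show ?case
    by (simp add: bounded_bilinear.continuous_on[OF B])
next
  case (Suc k)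
  from Ck_on_SucD[OF Suc.prems(1)] obtain f' where f':
    "\<And>x. x \<in> S \<Longrightarrow> (f has_derivative f' x) (at x)" "\<And>v. Ck_on k S (\<lambda>x. f' x v)"
    by blast
  from Ck_on_SucD[OF Suc.prems(2)] obtain g' where g':
    "\<And>x. x \<in> S \<Longrightarrow> (g has_derivative g' x) (at x)" "\<And>v. Ck_on k S (\<lambda>x. g' x v)"
    by blast
  have "Ck_on k S (\<lambda>x. B (f x) (g' x v) + B (f' x v) (g x))" for v
    by (rule Ck_on_add[OF assms(1) Suc.IH Suc.IH])
      (rule Suc.prems f'(2) g'(2) Ck_on_Suc_imp_Ck_on)+
  then show ?case
    using bounded_bilinear.FDERIV[OF B f'(1) g'(1)]
    by (intro Ck_on_SucI[OF assms(1), where f' = "\<lambda>x v. B (f x) (g' x v) + B (f' x v) (g x)"]) blast+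
qed

lemma Ck_on_diff:
  assumes "open S" and "Ck_on k S f" and "Ck_on k S g"
  shows "Ck_on k S (\<lambda>x. f x - g x)"
  using Ck_on_add[OF assms(1,2) Ck_on_bounded_linear[OF assms(1) bounded_linear_minus[OF bounded_linear_ident] assms(3)]]
  by simp

lemma linear_eq_sum_Basis:
  fixes L :: "'a::euclidean_space \<Rightarrow> 'b::real_normed_vector"
  assumes "linear L"
  shows "L v = (\<Sum>b\<in>Basis. (v \<bullet> b) *\<^sub>R L b)"
  by (subst euclidean_representation[of v, symmetric])
    (simp add: linear_sum[OF assms] linear_scale[OF assms])

text \<open>The chain rule gives \<open>(F \<circ> c)' v = F'(c x) (c' x v)\<close>, a composition in two arguments at once.
  Expanding \<open>c' x v\<close> in the basis turns it into a sum of products of \<open>C\<^sup>k\<close> maps, to which the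
  induction hypothesis applies; this is why \<open>F\<close> is generalized in the induction.\<close>

lemma Ck_on_compose:
  fixes F :: "'b::euclidean_space \<Rightarrow> 'c::real_normed_vector"
  assumes "open S" and "Ck_on k UNIV F" and "Ck_on k S c"
  shows "Ck_on k S (\<lambda>x. F (c x))"
  using assms(2,3)
proof (induction k arbitrary: F)
  case 0
  then show ?case
    using continuous_on_compose2[of UNIV F S c] by simp
next
  case (Suc k)
  from Ck_on_SucD[OF Suc.prems(1)] obtain F' where F':
    "\<And>x. x \<in> UNIV \<Longrightarrow> (F has_derivative F' x) (at x)" "\<And>v. Ck_on k UNIV (\<lambda>x. F' x v)"
    by blast
  from Ck_on_SucD[OF Suc.prems(2)] obtain c' where c':
    "\<And>x. x \<in> S \<Longrightarrow> (c has_derivative c' x) (at x)" "\<And>v. Ck_on k S (\<lambda>x. c' x v)"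
    by blast
  have "Ck_on k S (\<lambda>x. F' (c x) b)" for b
    using Suc.IH[OF F'(2) Ck_on_Suc_imp_Ck_on[OF Suc.prems(2)]] .
  then have sum_Ck: "Ck_on k S (\<lambda>x. \<Sum>b\<in>Basis. (c' x v \<bullet> b) *\<^sub>R F' (c x) b)" for v
    using c'(2)
    by (intro Ck_on_sum assms(1) Ck_on_bilinear[OF _ bounded_bilinear_scaleR]
        Ck_on_bounded_linear[OF _ bounded_linear_inner_left])
  have F'_sum: "F' y v = (\<Sum>b\<in>Basis. (v \<bullet> b) *\<^sub>R F' y b)" for y v
    by (rule linear_eq_sum_Basis[OF has_derivative_linear[OF F'(1)[OF UNIV_I]]])
  have "Ck_on k S (\<lambda>x. F' (c x) (c' x v))" for v
    by (rule Ck_on_cong[OF assms(1) F'_sum sum_Ck])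
  moreover have "((\<lambda>x. F (c x)) has_derivative (\<lambda>v. F' (c x) (c' x v))) (at x)" if "x \<in> S" for x
    using has_derivative_compose[OF c'(1)[OF that] F'(1)[OF UNIV_I]] .
  ultimately show ?case
    by (intro Ck_on_SucI[OF assms(1), where f' = "\<lambda>x v. F' (c x) (c' x v)"])
qed

lemma Ck_on_Suc_curveI:
  fixes c :: "real \<Rightarrow> 'b::real_normed_vector"
  assumes "open S" and "\<And>t. t \<in> S \<Longrightarrow> (c has_vector_derivative c' t) (at t)" and "Ck_on k S c'"
  shows "Ck_on (Suc k) S c"
  using assms(2) Ck_on_bounded_linear[OF assms(1) bounded_linear_scaleR_right assms(3)]
  by (intro Ck_on_SucI[OF assms(1), where f' = "\<lambda>t v. v *\<^sub>R c' t"]) (auto simp: has_vector_derivative_def)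

lemma Ck_on_Suc_curveD:
  fixes c :: "real \<Rightarrow> 'b::real_normed_vector"
  assumes "Ck_on (Suc k) S c"
  obtains c' where "\<And>t. t \<in> S \<Longrightarrow> (c has_vector_derivative c' t) (at t)" and "Ck_on k S c'"
proof -
  from Ck_on_SucD[OF assms] obtain D where D:
    "\<And>t. t \<in> S \<Longrightarrow> (c has_derivative D t) (at t)" "\<And>v. Ck_on k S (\<lambda>t. D t v)"
    by blast
  have "(c has_vector_derivative D t 1) (at t)" if "t \<in> S" for t
  proof -
    have "D t v = v *\<^sub>R D t 1" for v
      using linear_scale[OF has_derivative_linear[OF D(1)[OF that]], of v 1] by simp
    then have "D t = (\<lambda>v. v *\<^sub>R D t 1)"
      by (rule ext)
    then show ?thesis
      using D(1)[OF that] unfolding has_vector_derivative_def by metis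
  qed
  then show ?thesis
    by (rule that) (simp_all add: D(2))
qed

section \<open>Smooth dependence of solutions of linear equations\<close>

text \<open>Solutions of \<open>A u = g\<close> depend continuously on \<open>A\<close> and \<open>g\<close>: an injective \<open>A0\<close> is bounded
  below by some \<open>e > 0\<close>, so every operator within \<open>e/2\<close> of it is bounded below by \<open>e/2\<close>. Convergence
  of the operators is only required pointwise, which in finite dimension is the same as in norm.\<close>

lemma tendsto_linear_solve:
  fixes A :: "'i \<Rightarrow> 'a::euclidean_space \<Rightarrow> 'a"
  assumes "linear A0" and "inj A0"
    and lin: "eventually (\<lambda>t. linear (A t)) F"
    and lim: "\<And>b. ((\<lambda>t. A t b) \<longlongrightarrow> A0 b) F"
    and Au: "((\<lambda>t. A t (u t)) \<longlongrightarrow> A0 u0) F"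
  shows "(u \<longlongrightarrow> u0) F"
proof -
  obtain e where e: "e > 0" "\<And>x. e * norm x \<le> norm (A0 x)"
    using linear_inj_bounded_below_pos[OF assms(1,2)] by metis
  \<comment> \<open>bounds the operator norm of \<open>A t - A0\<close>\<close>
  define d where "d t = (\<Sum>b\<in>Basis. norm (A t b - A0 b))" for t
  have "(d \<longlongrightarrow> (\<Sum>b\<in>Basis. norm (A0 b - A0 b :: 'a))) F"
    unfolding d_def by (intro tendsto_intros lim)
  then have "(d \<longlongrightarrow> 0) F"
    by simp
  then have small: "eventually (\<lambda>t. d t < e / 2) F"
    by (rule order_tendstoD(2)) (use e(1) in simp)
  have bound: "norm (A t x - A0 x) \<le> d t * norm x" if "linear (A t)" for t x
  proof -
    have "A t x - A0 x = (\<Sum>b\<in>Basis. (x \<bullet> b) *\<^sub>R (A t b - A0 b))"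
      using linear_eq_sum_Basis[OF that, of x] linear_eq_sum_Basis[OF assms(1), of x]
      by (simp add: scaleR_diff_right sum_subtractf)
    also have "norm \<dots> \<le> (\<Sum>b\<in>Basis. norm x * norm (A t b - A0 b))"
      by (rule order_trans[OF norm_sum]) (auto intro!: sum_mono mult_right_mono Basis_le_norm)
    finally show ?thesis
      by (simp add: d_def sum_distrib_left mult.commute)
  qed
  have "((\<lambda>t. (2 / e) * norm (A t (u t) - A t u0)) \<longlongrightarrow> (2 / e) * norm (A0 u0 - A0 u0)) F"
    by (intro tendsto_intros Au lim)
  then have "((\<lambda>t. (2 / e) * norm (A t (u t) - A t u0)) \<longlongrightarrow> 0) F"
    by simp
  moreover have "eventually (\<lambda>t. norm (u t - u0) \<le> (2 / e) * norm (A t (u t) - A t u0)) F"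
    using small lin
  proof eventually_elim
    case (elim t)
    let ?x = "u t - u0"
    have "e * norm ?x \<le> norm (A t ?x) + norm (A t ?x - A0 ?x)"
      using e(2)[of ?x] norm_triangle_sub[of "A0 ?x" "A t ?x"] by (simp add: norm_minus_commute)
    also have "\<dots> \<le> norm (A t ?x) + (e / 2) * norm ?x"
      using bound[OF elim(2), of ?x] mult_right_mono[of "d t" "e / 2" "norm ?x"] elim(1) by simp
    finally show ?case
      using e(1) by (simp add: linear_diff[OF elim(2)] field_simps)
  qed
  ultimately have "((\<lambda>t. u t - u0) \<longlongrightarrow> 0) F"
    by (rule Lim_null_comparison[rotated])
  then show ?thesis
    using LIM_zero_iff by blast
qed

lemma has_vector_derivative_iff_quotient:
  "(f has_vector_derivative f') (at t) \<longleftrightarrow> ((\<lambda>s. (f s - f t) /\<^sub>R (s - t)) \<longlongrightarrow> f') (at t)"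
proof -
  have "norm (f s - f t - (s - t) *\<^sub>R f') / norm (s - t) = norm ((f s - f t) /\<^sub>R (s - t) - f')"
    if "s \<noteq> t" for s
  proof -
    have "(f s - f t) /\<^sub>R (s - t) - f' = (f s - f t - (s - t) *\<^sub>R f') /\<^sub>R (s - t)"
      using that by (simp add: scaleR_diff_right)
    then show ?thesis
      by (simp add: divide_inverse mult.commute)
  qed
  then have "((\<lambda>s. norm (f s - f t - (s - t) *\<^sub>R f') / norm (s - t)) \<longlongrightarrow> 0) (at t) \<longleftrightarrow>
      ((\<lambda>s. norm ((f s - f t) /\<^sub>R (s - t) - f')) \<longlongrightarrow> 0) (at t)"
    by (intro Lim_cong_within) auto
  then show ?thesis
    unfolding has_vector_derivative_def has_derivative_iff_norm tendsto_norm_zero_iff LIM_zero_iff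
    by (auto intro!: bounded_linear_intros)
qed

text \<open>Differentiating \<open>A w = g\<close> gives \<open>A w' = g' - A' w\<close>. That \<open>w\<close> is differentiable at all comes
  out of the proof: \<open>A s\<close> applied to the difference quotient of \<open>w\<close> equals the quotient of \<open>g\<close> minus that of \<open>A\<close>,
  so the difference quotient itself solves a linear equation whose data converge.\<close>

lemma has_vector_derivative_linear_solve:
  fixes A :: "real \<Rightarrow> 'a::euclidean_space \<Rightarrow> 'a"
  assumes "open S" and "t \<in> S"
    and lin: "\<And>s. s \<in> S \<Longrightarrow> linear (A s)" and inj: "inj (A t)"
    and A': "\<And>b. ((\<lambda>s. A s b) has_vector_derivative A' b) (at t)"
    and g': "(g has_vector_derivative g') (at t)"
    and eq: "\<And>s. s \<in> S \<Longrightarrow> A s (w s) = g s"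
    and w': "A t w' = g' - A' (w t)"
  shows "(w has_vector_derivative w') (at t)"
  unfolding has_vector_derivative_iff_quotient
proof (rule tendsto_linear_solve[OF lin[OF assms(2)] inj])
  have inS: "eventually (\<lambda>s. s \<in> S) (at t)"
    using assms(1,2) by (simp add: eventually_at_topological) blast
  then show "eventually (\<lambda>s. linear (A s)) (at t)"
    by (rule eventually_mono) (rule lin)
  show "((\<lambda>s. A s b) \<longlongrightarrow> A t b) (at t)" for b
    using has_vector_derivative_continuous[OF A'[of b]] by (simp add: continuous_within)
  have "((\<lambda>s. (g s - g t) /\<^sub>R (s - t) - (A s (w t) - A t (w t)) /\<^sub>R (s - t)) \<longlongrightarrow> g' - A' (w t)) (at t)"
    using A' g' unfolding has_vector_derivative_iff_quotient by (intro tendsto_diff)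
  moreover have "eventually (\<lambda>s. (g s - g t) /\<^sub>R (s - t) - (A s (w t) - A t (w t)) /\<^sub>R (s - t) =
      A s ((w s - w t) /\<^sub>R (s - t))) (at t)"
    using inS
    by eventually_elim
      (simp add: linear_scale[OF lin] linear_diff[OF lin] eq assms(2) scaleR_diff_right)
  ultimately show "((\<lambda>s. A s ((w s - w t) /\<^sub>R (s - t))) \<longlongrightarrow> A t w') (at t)"
    unfolding w' by (rule Lim_transform_eventually)
qed

text \<open>Bootstrapping: once \<open>w\<close> is of class \<open>C\<^sup>k\<close>, its derivative solves a linear equation with the
  same operators and a right-hand side of class \<open>C\<^sup>k\<close>, so it is of class \<open>C\<^sup>k\<close> as well. This replaces
  smoothness of operator inversion both in the inverse function theorem and for the Cayley
  transform below.\<close>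

lemma Ck_on_linear_solve:
  fixes A :: "real \<Rightarrow> 'a::euclidean_space \<Rightarrow> 'a"
  assumes "open S"
    and lin: "\<And>t. t \<in> S \<Longrightarrow> linear (A t)" and inj: "\<And>t. t \<in> S \<Longrightarrow> inj (A t)"
    and "\<And>b. Ck_on k S (\<lambda>t. A t b)" and "Ck_on k S g"
    and "\<And>t. t \<in> S \<Longrightarrow> A t (w t) = g t"
  shows "Ck_on k S w"
  using assms(4-6)
proof (induction k arbitrary: g w)
  case 0
  have "(w \<longlongrightarrow> w t) (at t within S)" if t: "t \<in> S" for t
  proof (rule tendsto_linear_solve[OF lin[OF t] inj[OF t]])
    show "eventually (\<lambda>s. linear (A s)) (at t within S)"
      using lin by (auto simp: eventually_at_filter)
    show "((\<lambda>s. A s b) \<longlongrightarrow> A t b) (at t within S)" for b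
      using 0(1) t by (simp add: continuous_on_def)
    have "(g \<longlongrightarrow> A t (w t)) (at t within S)"
      using 0(2,3) t by (simp add: continuous_on_def)
    moreover have "eventually (\<lambda>s. g s = A s (w s)) (at t within S)"
      using 0(3) by (auto simp: eventually_at_filter)
    ultimately show "((\<lambda>s. A s (w s)) \<longlongrightarrow> A t (w t)) (at t within S)"
      by (rule Lim_transform_eventually)
  qed
  then show ?case
    by (simp add: continuous_on_def)
next
  case (Suc k)
  have "\<forall>b. \<exists>A'. (\<forall>t\<in>S. ((\<lambda>s. A s b) has_vector_derivative A' t) (at t)) \<and> Ck_on k S A'"
    by (rule allI, rule Ck_on_Suc_curveD[OF Suc.prems(1)]) blast
  then obtain A' where A': "\<And>t b. t \<in> S \<Longrightarrow> ((\<lambda>s. A s b) has_vector_derivative A' b t) (at t)"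
    and A'_Ck: "\<And>b. Ck_on k S (A' b)"
    by metis
  from Ck_on_Suc_curveD[OF Suc.prems(2)] obtain g' where
    g': "\<And>t. t \<in> S \<Longrightarrow> (g has_vector_derivative g' t) (at t)" "Ck_on k S g'"
    by blast
  have A_k: "Ck_on k S (\<lambda>t. A t b)" for b
    by (rule Ck_on_Suc_imp_Ck_on) (rule Suc.prems)
  have w: "Ck_on k S w"
    using Suc.prems by (intro Suc.IH[OF A_k Ck_on_Suc_imp_Ck_on])
  \<comment> \<open>the candidate derivative is defined from the differentiated equation\<close>
  define w' where "w' t = (SOME v. A t v = g' t - A' (w t) t)" for t
  have w': "A t (w' t) = g' t - A' (w t) t" if "t \<in> S" for t
    unfolding w'_def
    using linear_injective_imp_surjective[OF lin inj, OF that that] by (metis (mono_tags) someI_ex surjD)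
  have "A' v t = (\<Sum>b\<in>Basis. (v \<bullet> b) *\<^sub>R A' b t)" if "t \<in> S" for v t
  proof (rule vector_derivative_unique_at)
    show "((\<lambda>s. A s v) has_vector_derivative A' v t) (at t)"
      using A' that .
    have "((\<lambda>s. \<Sum>b\<in>Basis. (v \<bullet> b) *\<^sub>R A s b) has_vector_derivative (\<Sum>b\<in>Basis. (v \<bullet> b) *\<^sub>R A' b t)) (at t)"
      by (auto intro!: derivative_eq_intros A' that)
    then show "((\<lambda>s. A s v) has_vector_derivative (\<Sum>b\<in>Basis. (v \<bullet> b) *\<^sub>R A' b t)) (at t)"
      by (rule has_vector_derivative_transform_within_open[OF _ assms(1) that])
        (simp add: linear_eq_sum_Basis[OF lin, of _ v])
  qed
  then have rhs: "g' t - A' (w t) t = g' t - (\<Sum>b\<in>Basis. (w t \<bullet> b) *\<^sub>R A' b t)" if "t \<in> S" for t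
    using that by simp
  have "Ck_on k S (\<lambda>t. g' t - A' (w t) t)"
    by (rule Ck_on_cong[OF assms(1) rhs])
      (auto intro!: Ck_on_diff Ck_on_sum assms(1) g'(2) w A'_Ck Ck_on_bilinear[OF _ bounded_bilinear_scaleR]
        Ck_on_bounded_linear[OF _ bounded_linear_inner_left])
  then have "Ck_on k S w'"
    using Suc.IH[OF A_k] w' by blast
  moreover have "(w has_vector_derivative w' t) (at t)" if "t \<in> S" for t
    using has_vector_derivative_linear_solve[OF assms(1) that lin inj[OF that] A'[OF that] g'(1)[OF that]
        Suc.prems(3) w'[OF that]] .
  ultimately show ?case
    by (intro Ck_on_Suc_curveI[OF assms(1)])
qed

section \<open>Tangent spaces of regular level sets\<close>

lemma smooth_on_Ck: "smooth_on S f \<Longrightarrow> Ck_on k S f"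
  by (simp add: smooth_on_def)

lemma smooth_has_derivative:
  assumes "smooth_on UNIV f"
  shows "(f has_derivative frechet_derivative f (at x)) (at x)"
  using smooth_on_Ck[OF assms, of "Suc 0"] by (simp add: frechet_derivative_works)

text \<open>The inverse function theorem yields a differentiable local inverse of \<open>\<Psi>\<close>. Only its
  restriction \<open>c\<close> to a line through \<open>\<Psi> x\<close> is needed, and that curve is smooth: \<open>c' t\<close> solves
  \<open>D\<Psi>(c t) (c' t) = v\<close>, so \<open>c'\<close> is as regular as \<open>c\<close>.\<close>

lemma smooth_inverse_along_line:
  fixes \<Psi> :: "'a::euclidean_space \<Rightarrow> 'a"
  assumes "smooth_on UNIV \<Psi>" and "frechet_derivative \<Psi> (at x) = (\<lambda>v. v)" and "\<Psi> x = 0"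
  obtains c \<epsilon> where "c 0 = x" "\<epsilon> > 0" "smooth_on {-\<epsilon><..<\<epsilon>} c"
    "\<And>t. t \<in> {-\<epsilon><..<\<epsilon>} \<Longrightarrow> \<Psi> (c t) = t *\<^sub>R v" "(c has_vector_derivative v) (at 0)"
proof -
  define D where "D = (\<lambda>y. frechet_derivative \<Psi> (at y))"
  have der: "(\<Psi> has_derivative D y) (at y)" for y
    unfolding D_def using smooth_has_derivative[OF assms(1)] .
  have D_Ck: "Ck_on k UNIV (\<lambda>y. D y w)" for k w
    using smooth_on_Ck[OF assms(1), of "Suc k"] by (simp add: D_def)
  have Dx: "D x = (\<lambda>v. v)"
    by (simp add: D_def assms(2))
  have bl: "bounded_linear (D y)" for y
    using der by (rule has_derivative_bounded_linear)
  have app: "blinfun_apply (Blinfun (D y)) = D y" for y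
    using bl by (rule bounded_linear_Blinfun_apply)
  have "continuous_on UNIV (\<lambda>y. Blinfun (D y))"
    by (rule continuous_on_blinfun_componentwise) (use D_Ck[of 0] in \<open>simp add: app\<close>)
  moreover have "id_blinfun o\<^sub>L Blinfun (D x) = id_blinfun"
    by (rule blinfun_eqI) (simp add: Dx app[of x, unfolded Dx])
  ultimately obtain U V g g' where UV: "open U" "x \<in> U" "open V" "\<Psi> x \<in> V"
    and hom: "homeomorphism U V \<Psi> g"
    and g: "\<And>y. y \<in> V \<Longrightarrow> (g has_derivative g' y) (at y)"
    and g': "\<And>y. y \<in> V \<Longrightarrow> g' y = inv (blinfun_apply (Blinfun (D (g y))))"
    and bij: "\<And>y. y \<in> V \<Longrightarrow> bij (blinfun_apply (Blinfun (D (g y))))"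
    using inverse_function_theorem[of UNIV \<Psi> "\<lambda>y. Blinfun (D y)" x id_blinfun] der
    by (metis UNIV_I app open_UNIV)
  define c where "c t = g (t *\<^sub>R v)" for t
  have "open ((\<lambda>t::real. t *\<^sub>R v) -` V)"
    by (intro open_vimage UV continuous_intros)
  moreover have "0 \<in> (\<lambda>t::real. t *\<^sub>R v) -` V"
    using UV(4) assms(3) by simp
  ultimately obtain \<epsilon> where \<epsilon>: "\<epsilon> > 0" "ball 0 \<epsilon> \<subseteq> (\<lambda>t::real. t *\<^sub>R v) -` V"
    using openE by metis
  let ?I = "{-\<epsilon><..<\<epsilon>}"
  have I: "open ?I" "0 \<in> ?I"
    using \<epsilon>(1) by auto
  \<comment> \<open>the interval is chosen so that the line stays in the domain of the local inverse\<close>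
  have inV: "t *\<^sub>R v \<in> V" if "t \<in> ?I" for t
    using \<epsilon>(2) that by (auto simp: dist_norm subset_iff)
  have \<Psi>c: "\<Psi> (c t) = t *\<^sub>R v" if "t \<in> ?I" for t
    using hom inV[OF that] by (auto simp: homeomorphism_def c_def)
  have inj: "inj (D (c t))" if "t \<in> ?I" for t
    using bij[OF inV[OF that]] by (simp add: app c_def bij_def)
  define c' where "c' t = g' (t *\<^sub>R v) v" for t
  have c': "(c has_vector_derivative c' t) (at t)" if "t \<in> ?I" for t
  proof -
    have "((\<lambda>t. t *\<^sub>R v) has_derivative (\<lambda>s. s *\<^sub>R v)) (at t)"
      by (auto intro!: derivative_eq_intros)
    from has_derivative_compose[OF this g[OF inV[OF that]]]
    have "(c has_derivative (\<lambda>s. g' (t *\<^sub>R v) (s *\<^sub>R v))) (at t)"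
      unfolding c_def .
    then show ?thesis
      using linear_scale[OF has_derivative_linear[OF g[OF inV[OF that]]]]
      by (simp add: has_vector_derivative_def c'_def)
  qed
  have Dc': "D (c t) (c' t) = v" if "t \<in> ?I" for t
    using bij[OF inV[OF that]] g'[OF inV[OF that]] by (simp add: app c_def c'_def bij_is_surj surj_f_inv_f)
  have "Ck_on k ?I c" for k
  proof (induction k)
    case 0
    have "continuous (at t) c" if "t \<in> ?I" for t
      using has_vector_derivative_continuous[OF c'[OF that]] .
    then show ?case
      by (simp add: continuous_at_imp_continuous_on)
  next
    case (Suc k)
    have "Ck_on k ?I c'"
      by (rule Ck_on_linear_solve[where A = "\<lambda>t. D (c t)" and g = "\<lambda>t. v", OF I(1)])
        (blast intro: bounded_linear.linear[OF bl] inj Ck_on_compose[OF I(1) D_Ck Suc] Ck_on_const Dc')+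
    with c' show ?case
      by (intro Ck_on_Suc_curveI[OF I(1)])
  qed
  moreover have c0: "c 0 = x"
    using hom UV(2) assms(3) by (auto simp: homeomorphism_def c_def)
  moreover have "(c has_vector_derivative v) (at 0)"
    using c'[OF I(2)] Dc'[OF I(2)] by (simp add: c0 Dx)
  ultimately show ?thesis
    using \<epsilon>(1) \<Psi>c by (intro that) (auto simp: smooth_on_def)
qed

lemma smooth_curve_through_derivative_zero:
  assumes "smooth_curve_through M x c" and "\<And>y. y \<in> M \<Longrightarrow> F y = k"
    and F: "(F has_derivative D) (at x)" and c: "(c has_vector_derivative v) (at 0)"
  shows "D v = 0"
proof -
  obtain \<epsilon> where \<epsilon>: "c 0 = x" "\<epsilon> > 0" "c ` {-\<epsilon><..<\<epsilon>} \<subseteq> M"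
    using assms(1) by (auto simp: smooth_curve_through_def)
  have "((\<lambda>t. F (c t)) has_derivative (\<lambda>t. D (t *\<^sub>R v))) (at 0)"
    using has_derivative_compose[of c "\<lambda>t. t *\<^sub>R v" 0 UNIV F D] F c \<epsilon>(1)
    by (simp add: has_vector_derivative_def)
  then have "((\<lambda>t. k) has_derivative (\<lambda>t. D (t *\<^sub>R v))) (at 0)"
    by (rule has_derivative_transform_within_open[where s = "{-\<epsilon><..<\<epsilon>}"]) (use \<epsilon> assms(2) in \<open>auto simp: image_subset_iff\<close>)
  then have "(\<lambda>t. D (t *\<^sub>R v)) = (\<lambda>t. 0)"
    by (rule has_derivative_unique) (rule has_derivative_const)
  then have "D (1 *\<^sub>R v) = 0"
    by metis
  then show ?thesis
    by simp
qed

text \<open>Every kernel vector \<open>v\<close> of the surjective differential \<open>L\<close> must be the velocity of a smooth curve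
  in the level set. With a right inverse \<open>R\<close> of \<open>L\<close>, the map
  \<open>\<Psi> y = (y - x) - R (L (y - x)) + R (F y)\<close> has derivative the identity at \<open>x\<close> and satisfies \<open>L \<circ> \<Psi> = F\<close>.
  A curve with \<open>\<Psi> (c t) = t v\<close> therefore satisfies \<open>F (c t) = t (L v) = 0\<close> and has velocity \<open>v\<close>.\<close>

theorem tangent_space_level_set:
  fixes F :: "'a::euclidean_space \<Rightarrow> 'b::euclidean_space"
  assumes "smooth_on UNIV F" and "surj (frechet_derivative F (at x))" and "F x = 0"
  shows "tangent_space {y. F y = 0} x = {v. frechet_derivative F (at x) v = 0}"
proof (intro equalityI subsetI)
  fix v assume "v \<in> tangent_space {y. F y = 0} x"
  then obtain c where c: "smooth_curve_through {y. F y = 0} x c" "(c has_vector_derivative v) (at 0)"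
    by (auto simp: tangent_space_def)
  have "frechet_derivative F (at x) v = 0"
    by (rule smooth_curve_through_derivative_zero[OF c(1) _ smooth_has_derivative[OF assms(1)] c(2), where k = 0])
      simp
  then show "v \<in> {v. frechet_derivative F (at x) v = 0}"
    by simp
next
  define L where "L = frechet_derivative F (at x)"
  have L: "linear L"
    unfolding L_def using has_derivative_linear[OF smooth_has_derivative[OF assms(1)]] .
  fix v assume "v \<in> {v. frechet_derivative F (at x) v = 0}"
  then have v: "L v = 0"
    by (simp add: L_def)
  obtain R where R: "linear R" "L \<circ> R = id"
    using linear_surjective_right_inverse[OF L] assms(2) L_def by metis
  have LR: "L (R y) = y" for y
    using R(2) by (metis comp_apply id_apply)
  define \<Psi> where "\<Psi> y = y - x - R (L (y - x)) + R (F y)" for y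
  have R': "bounded_linear R" "bounded_linear (\<lambda>y. R (L y))"
    using R(1) linear_compose[OF L R(1)] by (simp_all add: linear_conv_bounded_linear o_def)
  have "Ck_on k UNIV \<Psi>" for k
    unfolding \<Psi>_def
    by (intro Ck_on_add Ck_on_diff Ck_on_const Ck_on_id Ck_on_bounded_linear[OF _ R'(1)]
        Ck_on_bounded_linear[OF _ R'(2)] smooth_on_Ck[OF assms(1)] open_UNIV)
  then have "smooth_on UNIV \<Psi>"
    by (simp add: smooth_on_def)
  moreover have "(\<Psi> has_derivative (\<lambda>v. v - R (L v) + R (L v))) (at x)"
    unfolding \<Psi>_def L_def
    by (auto intro!: derivative_eq_intros bounded_linear.has_derivative[OF R'(1)]
        bounded_linear.has_derivative[OF R'(2)[unfolded L_def]] smooth_has_derivative[OF assms(1)])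
  then have "frechet_derivative \<Psi> (at x) = (\<lambda>v. v)"
    by (simp add: frechet_derivative_eqI)
  moreover have "\<Psi> x = 0"
    by (simp add: \<Psi>_def assms(3) linear_0[OF L] linear_0[OF R(1)])
  ultimately obtain c \<epsilon> where c: "c 0 = x" "\<epsilon> > 0" "smooth_on {-\<epsilon><..<\<epsilon>} c"
    "\<And>t. t \<in> {-\<epsilon><..<\<epsilon>} \<Longrightarrow> \<Psi> (c t) = t *\<^sub>R v" "(c has_vector_derivative v) (at 0)"
    using smooth_inverse_along_line by metis
  have "L (\<Psi> y) = F y" for y
    by (simp add: \<Psi>_def linear_add[OF L] linear_diff[OF L] LR)
  then have "F (c t) = 0" if "t \<in> {-\<epsilon><..<\<epsilon>}" for t
    using c(4)[OF that] by (metis v linear_scale[OF L] scaleR_zero_right)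
  then have "c ` {-\<epsilon><..<\<epsilon>} \<subseteq> {y. F y = 0}"
    by blast
  then show "v \<in> tangent_space {y. F y = 0} x"
    using c(1,2,3,5) unfolding tangent_space_def smooth_curve_through_def by blast
qed

section \<open>Matrix algebra and orthogonal matrices\<close>

lemma bounded_bilinear_matrix_mult:
  "bounded_bilinear ((**) :: real^'n^'m \<Rightarrow> real^'p^'n \<Rightarrow> real^'p^'m)"
  unfolding bilinear_conv_bounded_bilinear[symmetric] bilinear_def
  by (auto intro!: linearI simp: matrix_matrix_mult_def vec_eq_iff sum.distrib sum_distrib_left
      distrib_left distrib_right mult.left_commute mult.assoc)

lemmas matrix_mult_ring_simps =
  bounded_bilinear.add_left[OF bounded_bilinear_matrix_mult]
  bounded_bilinear.add_right[OF bounded_bilinear_matrix_mult]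
  bounded_bilinear.diff_left[OF bounded_bilinear_matrix_mult]
  bounded_bilinear.diff_right[OF bounded_bilinear_matrix_mult]
  bounded_bilinear.minus_left[OF bounded_bilinear_matrix_mult]
  bounded_bilinear.minus_right[OF bounded_bilinear_matrix_mult]
  bounded_bilinear.scaleR_left[OF bounded_bilinear_matrix_mult]
  bounded_bilinear.scaleR_right[OF bounded_bilinear_matrix_mult]

lemma bounded_linear_transpose: "bounded_linear (transpose :: real^'n^'m \<Rightarrow> real^'m^'n)"
  unfolding linear_conv_bounded_linear[symmetric]
  by (rule linearI) (simp_all add: transpose_def vec_eq_iff)

lemmas transpose_ring_simps =
  linear_add[OF bounded_linear.linear[OF bounded_linear_transpose]]
  linear_diff[OF bounded_linear.linear[OF bounded_linear_transpose]]
  linear_neg[OF bounded_linear.linear[OF bounded_linear_transpose]]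
  linear_0[OF bounded_linear.linear[OF bounded_linear_transpose]]

lemma inner_transpose: "transpose A \<bullet> transpose B = A \<bullet> (B :: real^'n^'m)"
  unfolding inner_vec_def transpose_def by (simp, rule sum.swap)

lemma inner_matrix_mult_left:
  fixes A :: "real^'n^'m" and B :: "real^'p^'n"
  shows "(A ** B) \<bullet> C = B \<bullet> (transpose A ** C)"
  unfolding frob_eq_inner[symmetric] frob_def by (simp add: matrix_transpose_mul matrix_mul_assoc)

lemma inner_matrix_mult_right:
  fixes A :: "real^'n^'m" and B :: "real^'p^'n"
  shows "(A ** B) \<bullet> C = A \<bullet> (C ** transpose B)"
proof -
  have "(A ** B) \<bullet> C = (transpose B ** transpose A) \<bullet> transpose C"
    by (metis inner_transpose matrix_transpose_mul)
  also have "\<dots> = transpose A \<bullet> transpose (C ** transpose B)"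
    by (simp add: inner_matrix_mult_left matrix_transpose_mul)
  finally show ?thesis
    by (simp add: inner_transpose)
qed

lemma matrix_inv_invertible:
  fixes A :: "real^'n^'n"
  assumes "invertible A"
  shows "A ** matrix_inv A = mat 1" and "matrix_inv A ** A = mat 1"
  unfolding matrix_inv_def using someI_ex[OF assms[unfolded invertible_def]] by blast+

lemma invertible_of_inner_pos:
  fixes A :: "real^'n^'n"
  assumes "\<And>x. x \<noteq> 0 \<Longrightarrow> x \<bullet> (A *v x) > 0"
  shows "invertible A"
proof -
  have "inj ((*v) A)"
    using assms by (fastforce simp: linear_injective_0[OF matrix_vector_mul_linear])
  then show ?thesis
    by (simp add: invertible_left_inverse matrix_left_invertible_injective)
qed

text \<open>The tangent space of the orthogonal group at the identity consists of the skew matrices. The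
  Cayley transform \<open>(1 - t/2 A)\<^sup>-\<^sup>1 (1 + t/2 A)\<close> realizes the velocity \<open>A\<close>; it is used
  rather than the matrix exponential because it solves a linear equation with affine coefficients,
  from which smoothness, derivative and orthogonality all follow.\<close>

lemma cayley_curve:
  fixes A :: "real^'n^'n"
  assumes skew: "transpose A = - A"
  obtains Q where "smooth_on UNIV Q" "Q 0 = mat 1" "\<And>t. orthogonal_matrix (Q t)"
    "(Q has_vector_derivative A) (at (0::real))"
proof -
  define Z where "Z t = mat 1 - (t / 2) *\<^sub>R A" for t :: real
  have ZT: "transpose (Z t) = mat 1 + (t / 2) *\<^sub>R A" for t
    by (simp add: Z_def transpose_ring_simps transpose_scalar skew)
  have "x \<bullet> (A *v x) = 0" for x
  proof -
    have "x \<bullet> (A *v x) = (transpose A *v x) \<bullet> x"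
      by (simp add: dot_lmul_matrix)
    also have "\<dots> = - (x \<bullet> (A *v x))"
      unfolding skew
      by (simp add: inner_commute matrix_vector_mult_def inner_vec_def sum_negf)
    finally show ?thesis
      by simp
  qed
  then have "invertible (Z t)" for t
    by (intro invertible_of_inner_pos)
      (simp add: Z_def matrix_vector_mult_diff_rdistrib scaleR_matrix_vector_assoc[symmetric] inner_diff_right)
  note Z_inv = matrix_inv_invertible[OF this]
  define Q where "Q t = matrix_inv (Z t) ** transpose (Z t)" for t
  have ZQ: "Z t ** Q t = transpose (Z t)" for t
    by (simp add: Q_def matrix_mul_assoc Z_inv)
  have lin: "linear (\<lambda>W. Z t ** W)" for t
    using bounded_bilinear.bounded_linear_right[OF bounded_bilinear_matrix_mult] by (rule bounded_linear.linear)
  have inj: "inj (\<lambda>W. Z t ** W)" for t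
    by (rule inj_on_inverseI[where g = "\<lambda>W. matrix_inv (Z t) ** W"]) (simp add: matrix_mul_assoc Z_inv)
  have deriv_half: "((\<lambda>s. mat 1 + (s / 2) *\<^sub>R B) has_vector_derivative (1 / 2) *\<^sub>R B) (at t)"
    for B :: "real^'n^'n" and t
    by (auto intro!: derivative_eq_intros simp: has_vector_derivative_def)
  have affine_Ck: "Ck_on k UNIV (\<lambda>t::real. C + (t / 2) *\<^sub>R B)" for k and B C :: "real^'n^'n"
    by (intro Ck_on_add open_UNIV Ck_on_const
        Ck_on_bounded_linear[where L = "\<lambda>t. (t / 2) *\<^sub>R B", OF _ _ Ck_on_id])
      (auto simp: linear_conv_bounded_linear[symmetric] intro!: linearI simp: scaleR_left_distrib add_divide_distrib)
  have "Ck_on k UNIV Q" for k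
  proof (rule Ck_on_linear_solve[OF open_UNIV lin inj _ _ ZQ])
    show "Ck_on k UNIV (\<lambda>t. Z t ** b)" for b :: "real^'n^'n"
      using affine_Ck[of k b "- (A ** b)"] by (simp add: Z_def matrix_mult_ring_simps)
    show "Ck_on k UNIV (\<lambda>t. transpose (Z t))"
      unfolding ZT by (rule affine_Ck)
  qed
  then have "smooth_on UNIV Q"
    by (simp add: smooth_on_def)
  moreover have "Q 0 = mat 1"
    using Z_inv[of 0] by (simp add: Q_def Z_def)
  moreover have "(Q has_vector_derivative A) (at 0)"
  proof (rule has_vector_derivative_linear_solve[where A = "\<lambda>t W. Z t ** W", OF open_UNIV UNIV_I lin inj _ _ ZQ])
    show "((\<lambda>s. Z s ** b) has_vector_derivative (- 1 / 2) *\<^sub>R (A ** b)) (at 0)" for b :: "real^'n^'n"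
      unfolding Z_def matrix_mult_ring_simps
      by (auto intro!: derivative_eq_intros simp: has_vector_derivative_def)
    show "((\<lambda>t. transpose (Z t)) has_vector_derivative (1 / 2) *\<^sub>R A) (at 0)"
      unfolding ZT by (rule deriv_half)
    show "Z 0 ** A = (1 / 2) *\<^sub>R A - (- 1 / 2) *\<^sub>R (A ** Q 0)"
      using \<open>Q 0 = mat 1\<close> by (simp add: Z_def scaleR_left_distrib[symmetric])
  qed
  moreover have "orthogonal_matrix (Q t)" for t
  proof -
    have "(mat 1 - B) ** (mat 1 + B) = (mat 1 + B) ** (mat 1 - B)" for B :: "real^'n^'n"
      by (simp add: matrix_mult_ring_simps)
    then have comm: "Z t ** transpose (Z t) = transpose (Z t) ** Z t"
      unfolding ZT unfolding Z_def .
    have "Z t ** (Q t ** transpose (Q t)) ** transpose (Z t) = transpose (Z t) ** Z t"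
      using ZQ[of t] by (metis matrix_mul_assoc matrix_transpose_mul transpose_transpose)
    then have "Z t ** (Q t ** transpose (Q t)) ** transpose (Z t) = Z t ** mat 1 ** transpose (Z t)"
      using comm by simp
    then have "matrix_inv (Z t) ** (Z t ** (Q t ** transpose (Q t)) ** transpose (Z t)) ** transpose (matrix_inv (Z t)) =
      matrix_inv (Z t) ** (Z t ** mat 1 ** transpose (Z t)) ** transpose (matrix_inv (Z t))"
      by simp
    moreover have "transpose (Z t) ** transpose (matrix_inv (Z t)) = mat 1"
      by (simp add: matrix_transpose_mul[symmetric] Z_inv)
    then have "matrix_inv (Z t) ** (Z t ** W ** transpose (Z t)) ** transpose (matrix_inv (Z t)) = W" for W
      using Z_inv(2)[of t] by (metis matrix_mul_assoc matrix_mul_lid matrix_mul_rid)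
    ultimately have "Q t ** transpose (Q t) = mat 1"
      by metis
    then show ?thesis
      using matrix_left_right_inverse by (auto simp: orthogonal_matrix)
  qed
  ultimately show ?thesis
    using that by blast
qed

text \<open>The prescribed rows span a subspace whose orthogonal complement has exactly the dimension given by
  the number of remaining row indices; an orthonormal basis of the complement fills them.\<close>

lemma orthonormal_family_extension:
  fixes c :: "'r::finite \<Rightarrow> real^'n" and \<iota> :: "'r \<Rightarrow> 'n"
  assumes "inj \<iota>" and orthonormal: "\<And>i j. c i \<bullet> c j = (if i = j then 1 else 0)"
  obtains Q :: "real^'n^'n" where "orthogonal_matrix Q" "\<And>k. row (\<iota> k) Q = c k"
proof -
  have "inj c"
    using orthonormal by (metis injI zero_neq_one)
  have "independent (range c)"
  proof (rule pairwise_orthogonal_independent)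
    show "pairwise orthogonal (range c)"
      using orthonormal by (auto simp: pairwise_def orthogonal_def)
    show "0 \<notin> range c"
      using orthonormal by (metis imageE inner_zero_left zero_neq_one)
  qed
  then have dim: "dim (range c) = CARD('r)"
    by (simp add: dim_eq_card_independent card_image \<open>inj c\<close>)
  define T where "T = {y. \<forall>x\<in>span (range c). orthogonal x y}"
  have "subspace T"
    unfolding T_def by (rule subspaceI) (auto simp: orthogonal_clauses)
  then obtain B where B: "B \<subseteq> T" "pairwise orthogonal B" "\<And>x. x \<in> B \<Longrightarrow> norm x = 1"
    "independent B" "card B = dim T"
    using orthonormal_basis_subspace by metis
  have "dim T + CARD('r) = CARD('n)"
    using dim_subspace_orthogonal_to_vectors[of "span (range c)" UNIV] by (simp add: T_def dim)
  moreover have "card (- range \<iota>) + CARD('r) = CARD('n)"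
    using card_Diff_subset[of "range \<iota>" UNIV] card_image[OF assms(1)] card_mono[of UNIV "range \<iota>"]
    by (simp add: Compl_eq_Diff_UNIV)
  ultimately obtain \<beta> where \<beta>: "bij_betw \<beta> (- range \<iota>) B"
    using finite_same_card_bij[of "- range \<iota>" B] independent_imp_finite[OF B(4)] B(5) by auto
  define q where "q j = (if j \<in> range \<iota> then c (inv \<iota> j) else \<beta> j)" for j
  have \<beta>_in: "\<beta> j \<in> B" if "j \<notin> range \<iota>" for j
    using \<beta> that by (auto simp: bij_betw_def)
  have cross: "orthogonal (c k) (\<beta> j)" if "j \<notin> range \<iota>" for j k
    using \<beta>_in[OF that] B(1) by (auto simp: T_def span_base)
  have rows: "row j (\<chi> j. q j) = q j" for j
    by (simp add: row_def vec_eq_iff)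
  have "orthogonal_matrix (\<chi> j. q j)"
    unfolding orthogonal_matrix_orthonormal_rows rows
  proof safe
    fix j
    show "norm (q j) = 1"
      using \<beta>_in B(3) orthonormal by (simp add: q_def norm_eq_1)
    fix l assume "j \<noteq> l"
    moreover have "\<beta> j \<noteq> \<beta> l" if "j \<notin> range \<iota>" "l \<notin> range \<iota>"
      using \<beta> that \<open>j \<noteq> l\<close> by (auto simp: bij_betw_def inj_on_def)
    ultimately show "orthogonal (q j) (q l)"
      using \<beta>_in B(2) cross cross[THEN orthogonal_commute[THEN iffD1]] assms(1)
      by (auto simp: q_def pairwise_def orthogonal_def[of "c _" "c _"] orthonormal)
  qed
  moreover have "row (\<iota> k) (\<chi> j. q j) = c k" for k
    unfolding rows using assms(1) by (simp add: q_def)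
  ultimately show ?thesis
    by (rule that)
qed

text \<open>The columns of \<open>V\<close>, placed as the rows of \<open>Q\<close> with index in the range of \<open>\<iota>\<close>, are the only rows that
  the padded matrix sees. Hence right multiplication by an orthogonal matrix turns \<open>[H 0]\<close> into
  \<open>H V\<^sup>T\<close>, simultaneously for all \<open>H\<close>.\<close>

lemma stiefel_eq_pad_columns_orthogonal:
  fixes V :: "real^'r^'n" and \<iota> :: "'r \<Rightarrow> 'n"
  assumes "inj \<iota>" and "V \<in> stiefel"
  obtains Q :: "real^'n^'n" where "orthogonal_matrix Q"
    "\<And>H :: real^'r^'m. H ** transpose V = pad_columns \<iota> H ** Q"
proof -
  have "(transpose V ** V) $ i $ j = (if i = j then 1 else 0)" for i j
    using assms(2) by (simp add: stiefel_def mat_def)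
  then have "column i V \<bullet> column j V = (if i = j then 1 else 0)" for i j
    by (simp add: matrix_mult_transpose_dot_column)
  then obtain Q :: "real^'n^'n" where Q: "orthogonal_matrix Q" "\<And>k. row (\<iota> k) Q = column k V"
    using orthonormal_family_extension[OF assms(1), of "\<lambda>k. column k V"] by metis
  have "Q $ \<iota> k $ l = V $ l $ k" for k l
    using arg_cong[OF Q(2)[of k], of "\<lambda>x. x $ l"] by (simp add: row_def column_def)
  moreover have "(pad_columns \<iota> H ** Q) $ i $ l = (\<Sum>k\<in>UNIV. H $ i $ k * Q $ \<iota> k $ l)" for H :: "real^'r^'m" and i l
  proof -
    have "(pad_columns \<iota> H ** Q) $ i $ l = (\<Sum>j\<in>range \<iota>. H $ i $ inv \<iota> j * Q $ j $ l)"
      unfolding matrix_matrix_mult_def pad_columns_def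
      by (simp add: if_distrib if_distribR sum.If_cases cong: if_cong)
    then show ?thesis
      by (simp add: sum.reindex[OF assms(1)] assms(1))
  qed
  ultimately have "H ** transpose V = pad_columns \<iota> H ** Q" for H :: "real^'r^'m"
    by (simp add: vec_eq_iff) (simp add: matrix_matrix_mult_def transpose_def)
  with Q(1) show ?thesis
    by (rule that)
qed

section \<open>Gradients and orthogonal projections\<close>

lemma euclidean_gradient_has_derivative:
  fixes f :: "'a::euclidean_space \<Rightarrow> real"
  assumes "f differentiable (at x)"
  shows "(f has_derivative (\<lambda>v. v \<bullet> euclidean_gradient f x)) (at x)"
proof -
  obtain D where D: "(f has_derivative D) (at x)"
    using assms by (auto simp: differentiable_def)
  \<comment> \<open>the Riesz representative of the derivative\<close>
  define g where "g = (\<Sum>b\<in>Basis. D b *\<^sub>R b)"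
  have "D v = v \<bullet> g" for v
    using linear_eq_sum_Basis[OF has_derivative_linear[OF D], of v]
    by (simp add: g_def inner_sum_right mult.commute)
  then have "D = (\<lambda>v. v \<bullet> g)"
    by (rule ext)
  then have g: "GDERIV f x :> g"
    using D by (simp add: gderiv_def)
  have "euclidean_gradient f x = g"
    unfolding euclidean_gradient_def
  proof (rule the_equality[where P = "\<lambda>D. GDERIV f x :> D", OF g])
    fix g' assume "GDERIV f x :> g'"
    then have "(\<lambda>v. v \<bullet> g') = (\<lambda>v. v \<bullet> g)"
      using g has_derivative_unique unfolding gderiv_def by blast
    then show "g' = g"
      by (metis inner_commute vector_eq_rdot)
  qed
  then show ?thesis
    using g by (simp add: gderiv_def)
qed

lemma orthogonal_projection_subspace:
  assumes "subspace S"
  shows "orthogonal_projection S A \<in> S" and "\<And>Z. Z \<in> S \<Longrightarrow> orthogonal_projection S A \<bullet> Z = A \<bullet> Z"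
proof -
  obtain P N where PN: "P \<in> span S" "\<And>w. w \<in> span S \<Longrightarrow> orthogonal N w" "A = P + N"
    using orthogonal_subspace_decomp_exists[of S A] by metis
  have S: "span S = S"
    using assms by (rule span_eq_iff[THEN iffD2])
  have P: "P \<in> S" "\<forall>Z\<in>S. frob (A - P) Z = 0"
    using PN by (auto simp: frob_eq_inner orthogonal_def S)
  have "orthogonal_projection S A = P"
    unfolding orthogonal_projection_def
  proof (rule the_equality)
    fix P' assume P': "P' \<in> S \<and> (\<forall>Z\<in>S. frob (A - P') Z = 0)"
    then have "P' - P \<in> S"
      using P(1) assms by (simp add: subspace_diff)
    then have "(A - P) \<bullet> (P' - P) - (A - P') \<bullet> (P' - P) = 0"
      using P' P(2) by (simp add: frob_eq_inner)
    then show "P' = P"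
      by (simp add: inner_diff_left[symmetric])
  qed (use P in blast)
  then show "orthogonal_projection S A \<in> S" "\<And>Z. Z \<in> S \<Longrightarrow> orthogonal_projection S A \<bullet> Z = A \<bullet> Z"
    using P by (auto simp: frob_eq_inner inner_diff_left)
qed

lemma weighted_ip_eq: "weighted_ip \<omega> \<xi> \<eta> = fst \<xi> \<bullet> fst \<eta> + \<omega> * (snd \<xi> \<bullet> snd \<eta>)"
  by (simp add: weighted_ip_def frob_eq_inner split_beta)

text \<open>Two gradients \<open>\<xi>\<close> and \<open>\<eta>\<close> pair equally with all tangent vectors, in particular with \<open>\<xi>\<close> and \<open>\<eta>\<close>
  themselves, so their difference has norm zero. Testing against \<open>\<xi>\<close> and \<open>\<eta>\<close> separately
  makes the argument valid for a set of velocities that is not known to be a linear space.\<close>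

lemma riemannian_gradient_eqI:
  assumes "\<omega> > 0" and \<xi>: "has_riemannian_gradient (weighted_ip \<omega>) M g x \<xi>"
  shows "riemannian_gradient (weighted_ip \<omega>) M g x = \<xi>"
  unfolding riemannian_gradient_def
proof (rule the_equality[where P = "has_riemannian_gradient (weighted_ip \<omega>) M g x", OF \<xi>])
  fix \<eta> assume \<eta>: "has_riemannian_gradient (weighted_ip \<omega>) M g x \<eta>"
  have eq: "weighted_ip \<omega> \<eta> v = weighted_ip \<omega> \<xi> v" if v: "v \<in> tangent_space M x" for v
  proof -
    obtain c where c: "smooth_curve_through M x c" "(c has_vector_derivative v) (at 0)"
      using v by (auto simp: tangent_space_def)
    have "((\<lambda>t. g (c t)) has_real_derivative weighted_ip \<omega> \<zeta> v) (at 0)"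
      if "has_riemannian_gradient (weighted_ip \<omega>) M g x \<zeta>" for \<zeta>
      using that c unfolding has_riemannian_gradient_def by blast
    from DERIV_unique[OF this[OF \<eta>] this[OF \<xi>]] show ?thesis .
  qed
  let ?d = "\<eta> - \<xi>"
  have "weighted_ip \<omega> \<eta> \<eta> = weighted_ip \<omega> \<xi> \<eta>" "weighted_ip \<omega> \<eta> \<xi> = weighted_ip \<omega> \<xi> \<xi>"
    using eq \<xi> \<eta> by (auto simp: has_riemannian_gradient_def)
  then have "fst ?d \<bullet> fst ?d + \<omega> * (snd ?d \<bullet> snd ?d) = 0"
    by (simp add: weighted_ip_eq inner_diff_left inner_diff_right algebra_simps)
  moreover have "0 \<le> fst ?d \<bullet> fst ?d" "0 \<le> \<omega> * (snd ?d \<bullet> snd ?d)"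
    using assms(1) by simp_all
  ultimately have "fst ?d \<bullet> fst ?d = 0" "\<omega> * (snd ?d \<bullet> snd ?d) = 0"
    by linarith+
  then show "\<eta> = \<xi>"
    using assms(1) by (simp add: prod_eq_iff)
qed

section \<open>Zero sets of orthogonally invariant maps\<close>

text \<open>The reflection \<open>Q = 1 - 2 G\<close> is orthogonal and fixes \<open>X\<close> because \<open>X G = 0\<close>. So the differential at
  \<open>X\<close> is invariant under \<open>E \<mapsto> E Q\<close>, while this map sends \<open>E G\<close> to \<open>- E G\<close>.\<close>

lemma orthogonally_invariant_derivative_zero:
  fixes h :: "real^'n^'m \<Rightarrow> 'b::real_normed_vector"
  assumes "orthogonally_invariant h" and Dh: "(h has_derivative D) (at X)"
    and G: "transpose G = G" "G ** G = G" and "X ** G = 0"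
  shows "D (E ** G) = 0"
proof -
  define Q where "Q = mat 1 - 2 *\<^sub>R G"
  have XQ: "X ** Q = X" and GQ: "G ** Q = - G"
    by (simp_all only: Q_def matrix_mult_ring_simps assms(5) G(2) matrix_mul_rid) (simp_all add: vec_eq_iff)
  have "transpose Q ** Q = mat 1"
    by (simp only: Q_def matrix_mult_ring_simps transpose_ring_simps transpose_scalar transpose_mat G
        matrix_mul_rid matrix_mul_lid) (simp add: vec_eq_iff)
  then have inv: "h (Y ** Q) = h Y" for Y
    using assms(1) by (simp add: orthogonally_invariant_def orthogonal_matrix)
  have "((\<lambda>Y. Y ** Q) has_derivative (\<lambda>Y. Y ** Q)) (at X)"
    by (rule bounded_linear_imp_has_derivative[OF bounded_bilinear.bounded_linear_left[OF bounded_bilinear_matrix_mult]])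
  from has_derivative_compose[OF this, of h D] Dh
  have "(h has_derivative (\<lambda>Y. D (Y ** Q))) (at X)"
    by (simp add: inv XQ)
  then have "D = (\<lambda>Y. D (Y ** Q))"
    by (rule has_derivative_unique[OF Dh])
  then have "D (E ** G) = D ((E ** G) ** Q)"
    by metis
  also have "\<dots> = - D (E ** G)"
    by (simp add: matrix_mul_assoc[symmetric] GQ matrix_mult_ring_simps linear_neg[OF has_derivative_linear[OF Dh]])
  finally have "2 *\<^sub>R D (E ** G) = 0"
    unfolding scaleR_2 eq_neg_iff_add_eq_0 .
  then show ?thesis
    by simp
qed

lemma orthogonally_invariant_pad_columns:
  assumes "orthogonally_invariant h" and "inj \<iota>" and "V \<in> stiefel"
  shows "h (pad_columns \<iota> H) = h (H ** transpose V)"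
  using stiefel_eq_pad_columns_orthogonal[OF assms(2,3)] assms(1)
  by (metis orthogonally_invariant_def)

text \<open>By orthogonal invariance \<open>\<H>\<^sup>r\<close> is the zero set of \<open>K \<mapsto> h (K V\<^sup>T)\<close>, whichever \<open>V\<close> in the Stiefel manifold
  is taken. The differential of \<open>h\<close> vanishes on matrices \<open>E G\<close> with \<open>G = 1 - V V\<^sup>T\<close>, so all of its
  range is attained on matrices \<open>K V\<^sup>T\<close>: the restricted map has a surjective differential too.\<close>

lemma tangent_space_Hr:
  fixes h :: "real^'n^'m \<Rightarrow> real^'q" and V :: "real^'r^'n"
  assumes "inj \<iota>" and h: "smooth_on UNIV h" "orthogonally_invariant h" "full_rank_on_zeros h"
    and V: "V \<in> stiefel" and "h (H ** transpose V) = 0"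
  shows "tangent_space (Hr \<iota> h) H =
    {K. frechet_derivative h (at (H ** transpose V)) (K ** transpose V) = 0}"
proof -
  let ?X = "H ** transpose V"
  define D where "D = frechet_derivative h (at ?X)"
  have D: "(h has_derivative D) (at ?X)"
    unfolding D_def using smooth_has_derivative[OF h(1)] .
  define F where "F K = h (K ** transpose V)" for K
  have mult: "bounded_linear (\<lambda>K. K ** transpose V)"
    by (rule bounded_bilinear.bounded_linear_left[OF bounded_bilinear_matrix_mult])
  have "Hr \<iota> h = {K. F K = 0}"
    by (simp add: Hr_def F_def orthogonally_invariant_pad_columns[OF h(2) assms(1) V])
  moreover have "Ck_on k UNIV F" for k
    unfolding F_def
    by (rule Ck_on_compose[where F = h, OF open_UNIV smooth_on_Ck[OF h(1)]
          Ck_on_bounded_linear[OF open_UNIV mult Ck_on_id[OF open_UNIV]]])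
  then have "smooth_on UNIV F"
    by (simp add: smooth_on_def)
  moreover have DF: "frechet_derivative F (at H) = (\<lambda>K. D (K ** transpose V))"
    unfolding F_def
    by (rule frechet_derivative_eqI)
      (rule has_derivative_compose[OF bounded_linear_imp_has_derivative[OF mult] D])
  moreover have "surj (\<lambda>K. D (K ** transpose V))"
  proof -
    let ?G = "mat 1 - V ** transpose V"
    have VV: "transpose V ** V = mat 1"
      using V by (simp add: stiefel_def)
    have VVV: "transpose V ** (V ** W) = W" for W :: "real^'n^'r"
      by (simp add: matrix_mul_assoc VV)
    have "D (E ** ?G) = 0" for E
      by (rule orthogonally_invariant_derivative_zero[OF h(2) D])
        (simp_all add: transpose_ring_simps matrix_transpose_mul matrix_mult_ring_simps
          matrix_mul_assoc[symmetric] VVV)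
    then have "D E = D (E ** V ** transpose V)" for E
      using linear_diff[OF has_derivative_linear[OF D], of E "E ** V ** transpose V"]
      by (simp add: matrix_mult_ring_simps matrix_mul_assoc)
    moreover have "range D = UNIV"
    proof -
      have "dim (range D) = DIM(real^'q)"
        using h(3) assms(6) by (simp add: full_rank_on_zeros_def D_def)
      then show ?thesis
        using dim_eq_full[of "range D"] linear_subspace_image[OF has_derivative_linear[OF D] subspace_UNIV]
        by (metis span_eq_iff)
    qed
    ultimately show ?thesis
      unfolding surj_def by (metis surjD)
  qed
  ultimately show ?thesis
    using tangent_space_level_set[of F H] assms(6) by (simp add: D_def F_def)
qed

section \<open>Tangent vectors of \<open>M\<^sub>h\<close> and their representations\<close>

lemma Ck_on_Pair:
  assumes "open S" and "Ck_on k S f" and "Ck_on k S g"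
  shows "Ck_on k S (\<lambda>x. (f x, g x))"
proof -
  have "Ck_on k S (\<lambda>x. (f x, 0) + (0, g x))"
    using assms by (intro Ck_on_add Ck_on_bounded_linear[where L = "\<lambda>a. (a, 0)"]
        Ck_on_bounded_linear[where L = "\<lambda>b. (0, b)"] bounded_linear_Pair bounded_linear_ident bounded_linear_zero)
  then show ?thesis
    by simp
qed

lemma rank_orthogonal_conjugate:
  fixes G Q :: "real^'n^'n"
  assumes "orthogonal_matrix Q"
  shows "rank (transpose Q ** G ** Q) = rank G"
proof (rule antisym)
  show "rank (transpose Q ** G ** Q) \<le> rank G"
    by (meson order_trans rank_mul_le_left rank_mul_le_right)
  have "G = Q ** (transpose Q ** G ** Q) ** transpose Q"
    using assms by (metis matrix_mul_assoc matrix_mul_lid matrix_mul_rid orthogonal_matrix_def)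
  then show "rank G \<le> rank (transpose Q ** G ** Q)"
    by (metis order_trans rank_mul_le_left rank_mul_le_right)
qed

lemma grassmannian_orthogonal_conjugate:
  assumes "G \<in> grassmannian k" and Q: "orthogonal_matrix Q"
  shows "transpose Q ** G ** Q \<in> grassmannian k"
proof -
  have "transpose Q ** G ** Q ** (transpose Q ** G ** Q) = transpose Q ** (G ** (Q ** transpose Q) ** G) ** Q"
    by (simp add: matrix_mul_assoc)
  also have "\<dots> = transpose Q ** G ** Q"
    using assms by (simp add: grassmannian_def orthogonal_matrix_def)
  finally have "transpose Q ** G ** Q ** (transpose Q ** G ** Q) = transpose Q ** G ** Q" .
  moreover have "transpose (transpose Q ** G ** Q) = transpose Q ** G ** Q"
    using assms(1) by (simp add: grassmannian_def matrix_transpose_mul matrix_mul_assoc)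
  ultimately show ?thesis
    using assms by (simp add: grassmannian_def rank_orthogonal_conjugate)
qed

lemma has_vector_derivative_matrix_mult:
  fixes f :: "real \<Rightarrow> real^'n^'m" and g :: "real \<Rightarrow> real^'p^'n"
  assumes "(f has_vector_derivative f') (at t)" and "(g has_vector_derivative g') (at t)"
  shows "((\<lambda>t. f t ** g t) has_vector_derivative (f t ** g' + f' ** g t)) (at t)"
  using bounded_bilinear.has_vector_derivative[OF bounded_bilinear_matrix_mult assms] .

lemma has_vector_derivative_transpose:
  assumes "(f has_vector_derivative f') (at t)"
  shows "((\<lambda>t. transpose (f t :: real^'n^'m)) has_vector_derivative transpose f') (at t)"
  using bounded_linear.has_vector_derivative[OF bounded_linear_transpose assms] .

lemma stiefel_absorb:
  assumes "V \<in> stiefel"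
  shows "transpose V ** V = mat 1" and "transpose V ** (V ** W) = W"
  using assms by (simp_all add: stiefel_def matrix_mul_assoc)

lemma orthogonal_column_space_absorb:
  fixes V Vp :: "real^'r^'n"
  assumes "transpose V ** Vp = 0"
  shows "transpose V ** (Vp ** W) = 0" and "transpose Vp ** V = 0" and "transpose Vp ** (V ** W) = 0"
proof -
  show "transpose Vp ** V = 0"
    using arg_cong[OF assms, of transpose] by (simp add: matrix_transpose_mul transpose_ring_simps)
  then show "transpose Vp ** (V ** W) = 0" "transpose V ** (Vp ** W) = 0"
    by (simp_all add: matrix_mul_assoc assms)
qed

text \<open>Take a curve \<open>H(t)\<close> in \<open>\<H>\<^sup>r\<close> with velocity \<open>K\<close> and a curve \<open>Q(t)\<close> of orthogonal matrices
  that starts at the identity with velocity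
  \<open>A = V V\<^sub>p\<^sup>T - V\<^sub>p V\<^sup>T\<close>. Then \<open>(H(t) V\<^sup>T Q(t), Q(t)\<^sup>T G Q(t))\<close> stays in \<open>M\<^sub>h\<close>, since conjugation preserves
  projections and their rank and \<open>h\<close> does not see \<open>Q(t)\<close>. Its velocity is the represented vector.\<close>

lemma represents_tangent_in_tangent_space_Mh:
  fixes h :: "real^'n^'m \<Rightarrow> real^'q" and V :: "real^'r^'n"
  assumes "inj \<iota>" and inv: "orthogonally_invariant h"
    and XG: "(X, G) \<in> Mh k h" and rep: "represents_point \<iota> h H V (X, G)"
    and \<xi>: "represents_tangent \<iota> h H V K Vp \<xi>"
  shows "\<xi> \<in> tangent_space (Mh k h) (X, G)"
proof -
  have V: "V \<in> stiefel" and X: "X = H ** transpose V" and G: "G = mat 1 - V ** transpose V"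
    using rep by (auto simp: represents_point_def)
  have K: "K \<in> tangent_space (Hr \<iota> h) H" and Vp: "transpose V ** Vp = 0"
    and \<xi>_eq: "\<xi> = (K ** transpose V + H ** transpose Vp, - (Vp ** transpose V) - V ** transpose Vp)"
    using \<xi> by (auto simp: represents_tangent_def)
  note absorb = stiefel_absorb[OF V] orthogonal_column_space_absorb[OF Vp]
  obtain cH where cH: "smooth_curve_through (Hr \<iota> h) H cH" "(cH has_vector_derivative K) (at 0)"
    using K by (auto simp: tangent_space_def)
  obtain \<epsilon> where \<epsilon>: "cH 0 = H" "\<epsilon> > 0" "smooth_on {-\<epsilon><..<\<epsilon>} cH" "cH ` {-\<epsilon><..<\<epsilon>} \<subseteq> Hr \<iota> h"
    using cH(1) unfolding smooth_curve_through_def by blast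
  define A where "A = V ** transpose Vp - Vp ** transpose V"
  have "transpose A = - A"
    by (simp add: A_def transpose_ring_simps matrix_transpose_mul)
  then obtain Q where Q: "smooth_on UNIV Q" "Q 0 = mat 1" "\<And>t. orthogonal_matrix (Q t)"
    "(Q has_vector_derivative A) (at (0::real))"
    using cayley_curve by blast
  define c where "c t = (cH t ** transpose V ** Q t, transpose (Q t) ** G ** Q t)" for t
  have "c t \<in> Mh k h" if t: "t \<in> {-\<epsilon><..<\<epsilon>}" for t
  proof -
    have "cH t \<in> Hr \<iota> h"
      using \<epsilon>(4) t by blast
    then have "h (cH t ** transpose V ** Q t) = 0"
      using inv Q(3)[of t] orthogonally_invariant_pad_columns[OF inv assms(1) V, of "cH t"]
      by (simp add: Hr_def orthogonally_invariant_def)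
    moreover have "transpose V ** G = 0"
      by (simp add: G matrix_mult_ring_simps absorb)
    then have "cH t ** (transpose V ** (Q t ** transpose (Q t)) ** G) ** Q t = 0"
      using Q(3)[of t] by (simp add: orthogonal_matrix_def)
    then have "cH t ** transpose V ** Q t ** (transpose (Q t) ** G ** Q t) = 0"
      by (simp add: matrix_mul_assoc)
    ultimately show ?thesis
      using grassmannian_orthogonal_conjugate[OF _ Q(3)] XG by (simp add: c_def Mh_def)
  qed
  then have "c ` {-\<epsilon><..<\<epsilon>} \<subseteq> Mh k h"
    by blast
  moreover have "Ck_on l {-\<epsilon><..<\<epsilon>} c" for l
  proof -
    have Q': "Ck_on l {-\<epsilon><..<\<epsilon>} Q"
      using smooth_on_Ck[OF Q(1)] by (rule Ck_on_subset) simp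
    show ?thesis
      unfolding c_def
      by (intro Ck_on_Pair Ck_on_bilinear[OF _ bounded_bilinear_matrix_mult] Ck_on_const Q'
          Ck_on_bounded_linear[OF _ bounded_linear_transpose] open_greaterThanLessThan smooth_on_Ck[OF \<epsilon>(3)])
  qed
  then have "smooth_on {-\<epsilon><..<\<epsilon>} c"
    by (simp add: smooth_on_def)
  moreover have "c 0 = (X, G)"
    by (simp add: c_def \<epsilon>(1) Q(2) X)
  moreover have "(c has_vector_derivative \<xi>) (at 0)"
  proof -
    have dX: "((\<lambda>t. cH t ** transpose V ** Q t) has_vector_derivative
        (cH 0 ** transpose V ** A + (cH 0 ** 0 + K ** transpose V) ** Q 0)) (at 0)"
      by (intro has_vector_derivative_matrix_mult has_vector_derivative_const cH(2) Q(4))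
    have eX: "cH 0 ** transpose V ** A + (cH 0 ** 0 + K ** transpose V) ** Q 0 = fst \<xi>"
      by (simp add: \<xi>_eq A_def \<epsilon>(1) Q(2) matrix_mult_ring_simps matrix_mul_assoc[symmetric] absorb)
    have dG: "((\<lambda>t. transpose (Q t) ** G ** Q t) has_vector_derivative
        (transpose (Q 0) ** G ** A + (transpose (Q 0) ** 0 + transpose A ** G) ** Q 0)) (at 0)"
      by (intro has_vector_derivative_matrix_mult has_vector_derivative_transpose
          has_vector_derivative_const Q(4))
    have eG: "transpose (Q 0) ** G ** A + (transpose (Q 0) ** 0 + transpose A ** G) ** Q 0 = snd \<xi>"
      by (simp add: \<xi>_eq \<open>transpose A = - A\<close> Q(2))
        (simp add: A_def G matrix_mult_ring_simps matrix_mul_assoc[symmetric] absorb)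
    show ?thesis
      using has_vector_derivative_Pair[OF dX dG] unfolding eX eG c_def[abs_def] by simp
  qed
  ultimately show ?thesis
    using \<epsilon>(2) unfolding tangent_space_def smooth_curve_through_def by blast
qed

text \<open>Differentiating the equations \<open>X G = 0\<close>, \<open>G\<^sup>2 = G\<close>, \<open>G\<^sup>T = G\<close> and \<open>h X = 0\<close> along a curve constrains the
  velocity \<open>(X', G')\<close>. The representing pair can only be \<open>K = X' V\<close> and \<open>V\<^sub>p = - G' V\<close>; splitting each
  matrix \<open>W\<close> as \<open>W V V\<^sup>T + W G\<close> shows that it does represent the velocity.\<close>

lemma tangent_vector_Mh_represented:
  fixes h :: "real^'n^'m \<Rightarrow> real^'q" and V :: "real^'r^'n"
  assumes "inj \<iota>" and h: "smooth_on UNIV h" "orthogonally_invariant h" "full_rank_on_zeros h"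
    and XG: "(X, G) \<in> Mh k h" and rep: "represents_point \<iota> h H V (X, G)"
    and c: "smooth_curve_through (Mh k h) (X, G) c" "(c has_vector_derivative v) (at 0)"
  obtains K Vp where "represents_tangent \<iota> h H V K Vp v"
proof -
  have V: "V \<in> stiefel" and X: "X = H ** transpose V" and G: "G = mat 1 - V ** transpose V"
    using rep by (auto simp: represents_point_def)
  note absorb = stiefel_absorb[OF V]
  obtain X' G' where v: "v = (X', G')"
    by (cases v)
  have Mh: "snd y \<in> grassmannian (CARD('n) - k)" "fst y ** snd y = 0" "h (fst y) = 0" if "y \<in> Mh k h" for y
    using that by (auto simp: Mh_def)
  have fst': "(fst has_derivative fst) (at y)" and snd': "(snd has_derivative snd) (at y)"
    for y :: "(real^'n^'m) \<times> (real^'n^'n)"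
    by (auto intro: bounded_linear_imp_has_derivative bounded_linear_fst bounded_linear_snd)
  note mult' = bounded_bilinear.FDERIV[OF bounded_bilinear_matrix_mult]
  have DhX: "frechet_derivative h (at X) X' = 0"
  proof -
    have "((\<lambda>y. h (fst y)) has_derivative (\<lambda>w. frechet_derivative h (at X) (fst w))) (at (X, G))"
      using has_derivative_compose[OF fst', of h _ "(X, G)"] smooth_has_derivative[OF h(1), of X] by simp
    from smooth_curve_through_derivative_zero[OF c(1) Mh(3) this c(2)] show ?thesis
      by (simp add: v)
  qed
  have XG': "X ** G' + X' ** G = 0"
    using smooth_curve_through_derivative_zero[OF c(1) Mh(2) mult'[OF fst' snd'] c(2)] by (simp add: v)
  have GG': "G ** G' + G' ** G = G'"
  proof -
    have "snd y ** snd y - snd y = 0" if "y \<in> Mh k h" for y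
      using Mh(1)[OF that] by (simp add: grassmannian_def)
    from smooth_curve_through_derivative_zero[OF c(1) this has_derivative_diff[OF mult'[OF snd' snd'] snd'] c(2)]
    show ?thesis
      by (simp add: v)
  qed
  have TG': "transpose G' = G'"
  proof -
    have "transpose (snd y) - snd y = 0" if "y \<in> Mh k h" for y
      using Mh(1)[OF that] by (simp add: grassmannian_def)
    from smooth_curve_through_derivative_zero[OF c(1) this
        has_derivative_diff[OF bounded_linear.has_derivative[OF bounded_linear_transpose snd'] snd'] c(2)]
    show ?thesis
      by (simp add: v)
  qed
  define K where "K = X' ** V"
  define Vp where "Vp = - (G' ** V)"
  have GV: "G ** V = 0" and VG: "transpose V ** G = 0"
    by (simp_all add: G matrix_mult_ring_simps matrix_mul_assoc[symmetric] absorb)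
  have VGW: "transpose V ** (G ** W) = 0" for W :: "real^'r^'n"
    by (simp add: matrix_mul_assoc VG)
  have "G' ** V = G ** (G' ** V)"
    using arg_cong[OF GG', of "\<lambda>W. W ** V"] by (simp add: matrix_mult_ring_simps matrix_mul_assoc[symmetric] GV)
  then have VGV: "transpose V ** (G' ** V) = 0"
    using VGW by metis
  then have Vp: "transpose V ** Vp = 0"
    by (simp add: Vp_def matrix_mult_ring_simps)
  have TVp: "transpose Vp = - (transpose V ** G')"
    by (simp add: Vp_def transpose_ring_simps matrix_transpose_mul TG')
  have G_decomp: "W = W ** V ** transpose V + W ** G" for W :: "real^'n^'p"
    by (simp add: G matrix_mult_ring_simps matrix_mul_assoc)
  have X'G: "X' ** G = H ** transpose Vp"
    using XG' by (simp add: X TVp matrix_mult_ring_simps matrix_mul_assoc add_eq_0_iff)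
  have X'_eq: "X' = K ** transpose V + H ** transpose Vp"
    using G_decomp[of X'] by (simp add: K_def X'G)
  have "G' ** G = V ** (transpose V ** G')"
  proof -
    have "G ** G' + V ** (transpose V ** G') = G'"
      by (simp add: G matrix_mult_ring_simps matrix_mul_assoc)
    then show ?thesis
      using GG' by (metis add_left_imp_eq)
  qed
  then have G'_eq: "G' = - (Vp ** transpose V) - V ** transpose Vp"
    using G_decomp[of G'] unfolding TVp by (simp add: Vp_def matrix_mult_ring_simps)
  have "h X = 0"
    using XG by (simp add: Mh_def)
  \<comment> \<open>\<open>H V\<^sub>p\<^sup>T\<close> is an infinitesimal rotation of the row space of \<open>X\<close>, which \<open>h\<close> does not see; so only \<open>K\<close> is constrained\<close>
  have "frechet_derivative h (at X) (H ** transpose Vp ** G) = 0"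
    using XG by (intro orthogonally_invariant_derivative_zero[OF h(2) smooth_has_derivative[OF h(1)]])
      (auto simp: Mh_def grassmannian_def)
  moreover have "transpose Vp ** G = transpose Vp"
    using orthogonal_column_space_absorb[OF Vp] by (simp add: G matrix_mult_ring_simps)
  ultimately have "frechet_derivative h (at X) (H ** transpose Vp) = 0"
    by (simp add: matrix_mul_assoc[symmetric])
  then have "frechet_derivative h (at X) (K ** transpose V) = 0"
    using DhX linear_add[OF has_derivative_linear[OF smooth_has_derivative[OF h(1)]], of X "K ** transpose V" "H ** transpose Vp"]
    by (simp flip: X'_eq)
  then have "K \<in> tangent_space (Hr \<iota> h) H"
    using tangent_space_Hr[OF assms(1) h V, of H] \<open>h X = 0\<close> by (simp add: X)
  then have "represents_tangent \<iota> h H V K Vp v"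
    using Vp X'_eq G'_eq by (simp add: represents_tangent_def v)
  then show ?thesis
    by (rule that)
qed

section \<open>The weighted metric and the gradient formula\<close>

lemma M_weight_invertible:
  assumes "\<omega> > 0"
  shows "invertible (M_weight \<omega> (H :: real^'r^'m))"
proof (rule invertible_of_inner_pos)
  fix x :: "real^'r" assume "x \<noteq> 0"
  have "x \<bullet> ((transpose H ** H) *v x) = (H *v x) \<bullet> (H *v x)"
    using dot_lmul_matrix[of "H *v x" H x] by (simp add: matrix_vector_mul_assoc[symmetric] inner_commute[of x])
  then show "x \<bullet> (M_weight \<omega> H *v x) > 0"
    using assms \<open>x \<noteq> 0\<close>
    by (simp add: M_weight_def matrix_vector_mult_add_rdistrib scaleR_matrix_vector_assoc[symmetric]
        inner_add_right add_pos_nonneg)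
qed

text \<open>In terms of representing pairs the metric splits into the Frobenius product on the \<open>K\<close>-parts and a
  product weighted by \<open>M_weight\<close> on the \<open>V\<^sub>p\<close>-parts: the mixed terms contain \<open>V\<^sup>T V\<^sub>p\<close> or \<open>V\<^sup>T W\<close>
  and vanish, the term \<open>H\<^sup>T H\<close> comes from the first component, and \<open>2 \<omega>\<close> from the two equal halves of
  the second.\<close>

lemma weighted_ip_represented:
  fixes H K L :: "real^'r^'m" and V Vp W :: "real^'r^'n"
  assumes V: "V \<in> stiefel" and Vp: "transpose V ** Vp = 0" and W: "transpose V ** W = 0"
  shows "weighted_ip \<omega> (L ** transpose V + H ** transpose W, - (W ** transpose V) - V ** transpose W)
      (K ** transpose V + H ** transpose Vp, - (Vp ** transpose V) - V ** transpose Vp)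
    = L \<bullet> K + (W ** M_weight \<omega> H) \<bullet> Vp"
proof -
  note absorb = stiefel_absorb[OF V] orthogonal_column_space_absorb[OF Vp] orthogonal_column_space_absorb[OF W]
  have HW: "(H ** transpose W) \<bullet> (H ** transpose Vp) = (W ** (transpose H ** H)) \<bullet> Vp"
  proof -
    have "(H ** transpose W) \<bullet> (H ** transpose Vp) = transpose W \<bullet> transpose (Vp ** (transpose H ** H))"
      by (simp add: inner_matrix_mult_left matrix_transpose_mul matrix_mul_assoc)
    also have "\<dots> = W \<bullet> (Vp ** (transpose H ** H))"
      by (rule inner_transpose)
    finally show ?thesis
      by (simp add: inner_matrix_mult_right matrix_transpose_mul)
  qed
  have same: "(P ** transpose V) \<bullet> (R ** transpose V) = P \<bullet> R" for P R :: "real^'r^'p"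
    by (simp add: inner_matrix_mult_right matrix_mul_assoc[symmetric] absorb)
  have cross: "(P ** transpose V) \<bullet> (R ** transpose Vp) = 0" "(R ** transpose W) \<bullet> (P ** transpose V) = 0"
    for P R :: "real^'r^'p"
    by (simp_all add: inner_matrix_mult_right matrix_mul_assoc[symmetric] absorb W)
  have sameV: "(V ** transpose W) \<bullet> (V ** transpose Vp) = W \<bullet> Vp"
    by (simp add: inner_matrix_mult_left matrix_mul_assoc[symmetric] absorb inner_transpose)
  show ?thesis
    by (simp add: weighted_ip_eq M_weight_def inner_add_left inner_add_right inner_diff_left inner_diff_right
        same cross sameV HW matrix_mult_ring_simps algebra_simps)
qed

theorem proposition8:
  fixes \<iota> :: "'r::finite \<Rightarrow> 'n::finite"
    and h :: "real^'n^'m \<Rightarrow> real^'q"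
    and f :: "real^'n^'m \<Rightarrow> real"
    and \<omega> :: real
    and X :: "real^'n^'m" and G :: "real^'n^'n"
    and H :: "real^'r^'m" and V :: "real^'r^'n"
  assumes "CARD('r) \<le> min CARD('m) CARD('n)"
    and "inj \<iota>"
    and "smooth_on UNIV h"
    and "orthogonally_invariant h"
    and "full_rank_on_zeros h"
    and "\<omega> > 0"
    and "Ck_on 2 UNIV f"
    and "(X, G) \<in> Mh CARD('r) h"
    and "represents_point \<iota> h H V (X, G)"
  shows "let fbar = f \<circ> fst;
             grad = riemannian_gradient (weighted_ip \<omega>) (Mh CARD('r) h) fbar (X, G);
             Kbar = orthogonal_projection (tangent_space (Hr \<iota> h) H)
                      (euclidean_gradient f X ** V);
             Vpbar = G ** transpose (euclidean_gradient f X) ** H ** matrix_inv (M_weight \<omega> H)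
         in has_riemannian_gradient (weighted_ip \<omega>) (Mh CARD('r) h) fbar (X, G) grad
            \<and> represents_tangent \<iota> h H V Kbar Vpbar grad"
proof -
  have V: "V \<in> stiefel" and X: "X = H ** transpose V" and G: "G = mat 1 - V ** transpose V"
    using assms(9) by (auto simp: represents_point_def)
  have GT: "transpose G = G"
    using assms(8) by (simp add: Mh_def grassmannian_def)
  let ?T = "tangent_space (Hr \<iota> h) H"
  define E where "E = euclidean_gradient f X"
  define Kbar where "Kbar = orthogonal_projection ?T (E ** V)"
  define Vpbar where "Vpbar = G ** transpose E ** H ** matrix_inv (M_weight \<omega> H)"
  define \<xi> where "\<xi> = (Kbar ** transpose V + H ** transpose Vpbar,
    - (Vpbar ** transpose V) - V ** transpose Vpbar)"
  have "f differentiable (at X)"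
    using assms(7) by (simp add: numeral_2_eq_2)
  then have Df: "(f has_derivative (\<lambda>v. v \<bullet> E)) (at X)"
    unfolding E_def by (rule euclidean_gradient_has_derivative)
  have "h X = 0"
    using assms(8) by (simp add: Mh_def)
  then have T: "?T = {K. frechet_derivative h (at X) (K ** transpose V) = 0}"
    using tangent_space_Hr[OF assms(2-5) V, of H] by (simp add: X)
  have "subspace ?T"
  proof -
    have "linear (\<lambda>K. frechet_derivative h (at X) (K ** transpose V))"
      using linear_compose[OF bounded_linear.linear[OF bounded_bilinear.bounded_linear_left[OF bounded_bilinear_matrix_mult]]
          has_derivative_linear[OF smooth_has_derivative[OF assms(3)]]]
      by (simp add: o_def)
    from linear_subspace_kernel[OF this] show ?thesis
      by (simp add: T)
  qed
  note proj = orthogonal_projection_subspace[OF this, where A = "E ** V", folded Kbar_def]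
  have "transpose V ** G = 0"
    by (simp add: G matrix_mult_ring_simps stiefel_absorb[OF V])
  then have VVpbar: "transpose V ** Vpbar = 0"
    unfolding Vpbar_def by (metis matrix_mul_assoc times0_left)
  have rep: "represents_tangent \<iota> h H V Kbar Vpbar \<xi>"
    using proj(1) VVpbar by (simp add: represents_tangent_def \<xi>_def)
  \<comment> \<open>the factor \<open>M_weight\<close> that the metric puts on the \<open>V\<^sub>p\<close>-part cancels the inverse in \<open>Vpbar\<close>\<close>
  have "matrix_inv (M_weight \<omega> H) ** M_weight \<omega> H = mat 1"
    by (rule matrix_inv_invertible(2)[OF M_weight_invertible[OF assms(6)]])
  then have VpbarM: "Vpbar ** M_weight \<omega> H = G ** (transpose E ** H)"
    unfolding Vpbar_def by (metis matrix_mul_assoc matrix_mul_rid)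
  \<comment> \<open>the defining property of the gradient, tested on represented vectors\<close>
  have ip: "weighted_ip \<omega> \<xi> v = fst v \<bullet> E" if v: "represents_tangent \<iota> h H V K Vp v" for K Vp v
  proof -
    have K: "K \<in> ?T" and Vp: "transpose V ** Vp = 0"
      and v_eq: "v = (K ** transpose V + H ** transpose Vp, - (Vp ** transpose V) - V ** transpose Vp)"
      using v by (auto simp: represents_tangent_def)
    have "G ** Vp = Vp"
      by (simp add: G matrix_mult_ring_simps matrix_mul_assoc[symmetric] Vp)
    then have "(G ** (transpose E ** H)) \<bullet> Vp = (transpose E ** H) \<bullet> Vp"
      by (simp add: inner_matrix_mult_left GT)
    also have "\<dots> = (H ** transpose Vp) \<bullet> E"
      using inner_transpose[of "transpose H ** E" "transpose Vp"]
      by (simp add: inner_matrix_mult_left[of H] matrix_transpose_mul inner_commute[of "transpose Vp"])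
    finally have "(Vpbar ** M_weight \<omega> H) \<bullet> Vp = (H ** transpose Vp) \<bullet> E"
      by (simp add: VpbarM)
    moreover have "Kbar \<bullet> K = (K ** transpose V) \<bullet> E"
      using proj(2)[OF K] inner_matrix_mult_right[of K "transpose V" E] by (simp add: inner_commute)
    ultimately show ?thesis
      unfolding \<xi>_def v_eq weighted_ip_represented[OF V Vp VVpbar] by (simp add: inner_add_left)
  qed
  have grad: "has_riemannian_gradient (weighted_ip \<omega>) (Mh CARD('r) h) (f \<circ> fst) (X, G) \<xi>"
    unfolding has_riemannian_gradient_def
  proof (intro conjI allI impI)
    show "\<xi> \<in> tangent_space (Mh CARD('r) h) (X, G)"
      by (rule represents_tangent_in_tangent_space_Mh[OF assms(2,4,8,9) rep])
    fix c v assume c: "smooth_curve_through (Mh CARD('r) h) (X, G) c \<and> (c has_vector_derivative v) (at 0)"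
    then obtain K Vp where "represents_tangent \<iota> h H V K Vp v"
      using tangent_vector_Mh_represented[OF assms(2-5,8,9)] by metis
    then have "weighted_ip \<omega> \<xi> v = fst v \<bullet> E"
      by (rule ip)
    moreover have "((\<lambda>t. f (fst (c t))) has_derivative (\<lambda>t. fst (t *\<^sub>R v) \<bullet> E)) (at 0)"
    proof -
      have "((\<lambda>t. fst (c t)) has_derivative (\<lambda>t. fst (t *\<^sub>R v))) (at 0)"
        using c by (intro has_derivative_fst) (simp add: has_vector_derivative_def)
      moreover have "(f has_derivative (\<lambda>v. v \<bullet> E)) (at (fst (c 0)))"
        using c Df by (simp add: smooth_curve_through_def)
      ultimately show ?thesis
        by (rule has_derivative_compose)
    qed
    ultimately show "((\<lambda>t. (f \<circ> fst) (c t)) has_real_derivative weighted_ip \<omega> \<xi> v) (at 0)"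
      by (simp add: has_field_derivative_def mult_commute_abs)
  qed
  then have "riemannian_gradient (weighted_ip \<omega>) (Mh CARD('r) h) (f \<circ> fst) (X, G) = \<xi>"
    by (rule riemannian_gradient_eqI[OF assms(6)])
  then show ?thesis
    using grad rep by (simp add: Let_def E_def Kbar_def Vpbar_def)
qed

end
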